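(* ($N=4$.) Let $Z_{AB}=-Z_{BA}$ ($A,B=1,\dots,4$) and $Z_I$ ($I=1,\dots,n$) be the central and matter charges of $D=4$, $N=4$ supergravity coupled to $n$ vector multiplets. Under the infinitesimal transformations of $\frac{SU(1,1)}{U(1)}\times\frac{O(6,n)}{O(6)\times O(n)}$ they vary as $$\delta Z_{AB}=\tfrac12\,\xi\,\epsilon_{ABCD}\bar Z^{CD}+\xi_{AB\,I}\bar Z^I,\qquad \delta Z_I=\bar\xi\,\eta_{IJ}\bar Z^J+\tfrac12\,\xi_{AB\,I}\bar Z^{AB},$$ with $\bar\xi^{AB\,I}=\frac12\eta^{IJ}\epsilon^{ABCD}\xi_{CD\,J}$. There are three $O(6,n)$ invariants, given by $I_1$, $I_2$, $\bar I_2$, where $$I_1=\tfrac12 Z_{AB}\bar Z^{AB}-Z_I\bar Z^I,\qquad I_2=\tfrac14\epsilon^{ABCD}Z_{AB}Z_{CD}-\bar Z_I\bar Z^I ,$$ and the unique $SU(1,1)\times O(6,n)$ invariant $S$, satisfying $\nabla S=0$ (so that $S$ is independent of the moduli), is given by $$S=\sqrt{(I_1)^2-|I_2|^2}.$$ At the attractor point one has $Z_I=0$ and $\epsilon^{ABCD}Z_{AB}Z_{CD}=0$, so that $S$ reduces there to the square of the BPS mass.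
   Context: The scalar manifold of the theory is $\frac{SU(1,1)}{U(1)}\times\frac{O(6,n)}{O(6)\times O(n)}$, and $SU(1,1)\times O(6,n)$ is its isometry (U-duality) group. The charges $Z_{AB}$, $Z_I$ depend on the scalar fields (moduli) and on fixed electric and magnetic charges. They transform in the obvious way under the isotropy group $SU(4)\times O(n)\times U(1)$, and the displayed $\delta$ gives their variation in the coset directions: $\xi$ is the complex $SU(1,1)/U(1)$ parameter and $\xi_{AB\,I}=-\xi_{BA\,I}$ are the $O(6,n)/(O(6)\times O(n))$ parameters. The isotropy-group-covariant derivatives $\nabla Z_{AB}$, $\nabla Z_I$ with respect to the moduli have the same form as $\delta Z_{AB}$, $\delta Z_I$, with $\xi$ and $\xi_{AB\,I}$ replaced by the vielbeins $P$ and $P_{AB\,I}$ of the two coset factors. Bars denote complex conjugation: $\bar Z^{AB}=(Z_{AB})^*$, $\bar Z^I=(Z_I)^*$, $\bar\xi^{AB\,I}=(\xi_{AB\,I})^*$. $\epsilon$ is the totally antisymmetric symbol with $\epsilon_{1234}=\epsilon^{1234}=1$. $\eta_{IJ}=\delta_{IJ}$ is the $O(n)$-invariant metric, used to raise and lower $I,J$. Repeated indices are summed over their full ranges. The attractor point is the point of moduli space where the ADM mass of the extremal black hole preserving one supersymmetry is extremized; this mass is the BPS mass, i.e. the largest absolute value of the skew-eigenvalues of $Z_{AB}$. *)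

theory Defs
  imports "HOL-Analysis.Analysis"
begin

text \<open>
  A charge configuration is a pair \<open>(Z\<^sub>A\<^sub>B, Z\<^sub>I)\<close>.  The index type \<open>4\<close> of
  HOL-Library.Numeral_Type has the elements 1, 2, 3, 4 (where 4 = 0); \<open>'n\<close> is the index set
  of the vector multiplets, with \<open>n = CARD('n)\<close>.
\<close>

type_synonym 'n charges = "(complex ^ 4 ^ 4) \<times> (complex ^ 'n)"

definition charge_space :: "('n::finite) charges set" where
  "charge_space = {Z. transpose (fst Z) = - fst Z}"

definition eps :: "4 \<Rightarrow> 4 \<Rightarrow> 4 \<Rightarrow> 4 \<Rightarrow> complex" where
  "eps A B C D = det (vector [axis A 1, axis B 1, axis C 1, axis D 1] :: complex ^ 4 ^ 4)"

definition eta :: "'n \<Rightarrow> 'n \<Rightarrow> complex" where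
  "eta I J = (if I = J then 1 else 0)"

text \<open>
  The pairs \<open>(\<xi>, \<xi>\<^sub>A\<^sub>B\<^sub>I)\<close>; the second condition is the reality condition on the
  \<open>O(6,n)/(O(6) \<times> O(n))\<close> parameters.
\<close>

definition coset_params :: "(complex \<times> (complex ^ ('n::finite) ^ 4 ^ 4)) set" where
  "coset_params = {(\<xi>, \<Xi>).
     (\<forall>A B I. \<Xi> $ A $ B $ I = - (\<Xi> $ B $ A $ I)) \<and>
     (\<forall>A B I. cnj (\<Xi> $ A $ B $ I) =
        1/2 * (\<Sum>J\<in>UNIV. \<Sum>C\<in>UNIV. \<Sum>D\<in>UNIV. eta I J * eps A B C D * \<Xi> $ C $ D $ J))}"

definition coset_var ::
  "complex \<times> (complex ^ ('n::finite) ^ 4 ^ 4) \<Rightarrow> 'n charges \<Rightarrow> 'n charges" where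
  "coset_var p Z = (case p of (\<xi>, \<Xi>) \<Rightarrow>
     (\<chi> A B. 1/2 * \<xi> * (\<Sum>C\<in>UNIV. \<Sum>D\<in>UNIV. eps A B C D * cnj (fst Z $ C $ D))
             + (\<Sum>I\<in>UNIV. \<Xi> $ A $ B $ I * cnj (snd Z $ I)),
      \<chi> I. cnj \<xi> * (\<Sum>J\<in>UNIV. eta I J * cnj (snd Z $ J))
             + 1/2 * (\<Sum>A\<in>UNIV. \<Sum>B\<in>UNIV. \<Xi> $ A $ B $ I * cnj (fst Z $ A $ B))))"

text \<open>
  \<open>g\<close> is the finite coset transformation \<open>exp \<delta>\<close> with parameters \<open>p\<close>: the time-one map of
  the flow of the linear vector field \<open>coset_var p\<close>.  The values of \<open>g\<close> outside
  \<open>charge_space\<close> are irrelevant.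
\<close>

definition is_coset_exp ::
  "complex \<times> (complex ^ ('n::finite) ^ 4 ^ 4) \<Rightarrow> ('n charges \<Rightarrow> 'n charges) \<Rightarrow> bool" where
  "is_coset_exp p g \<longleftrightarrow> (\<forall>Z\<in>charge_space. \<exists>\<gamma> :: real \<Rightarrow> 'n charges.
     \<gamma> 0 = Z \<and> \<gamma> 1 = g Z \<and>
     (\<forall>t\<in>{0..1}. (\<gamma> has_vector_derivative coset_var p (\<gamma> t)) (at t within {0..1})))"

definition adjoint_matrix :: "complex ^ ('k::finite) ^ 'k \<Rightarrow> complex ^ 'k ^ 'k" where
  "adjoint_matrix U = (\<chi> i j. cnj (U $ j $ i))"

definition unitary_matrix :: "complex ^ ('k::finite) ^ 'k \<Rightarrow> bool" where
  "unitary_matrix U \<longleftrightarrow> U ** adjoint_matrix U = mat 1 \<and> adjoint_matrix U ** U = mat 1"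

definition SU4 :: "(complex ^ 4 ^ 4) set" where
  "SU4 = {U. unitary_matrix U \<and> det U = 1}"

text \<open>
  Action of \<open>(U, R, c) \<in> SU(4) \<times> O(n) \<times> U(1)\<close>.  The opposite \<open>U(1)\<close> weights of
  \<open>Z\<^sub>A\<^sub>B\<close> and \<open>Z\<^sub>I\<close> are forced by the commutator of two \<open>\<xi>\<close>-variations.
\<close>

definition isotropy ::
  "complex ^ 4 ^ 4 \<Rightarrow> real ^ ('n::finite) ^ 'n \<Rightarrow> complex \<Rightarrow> 'n charges \<Rightarrow> 'n charges" where
  "isotropy U R c Z =
     (\<chi> A B. c * (U ** fst Z ** transpose U) $ A $ B,
      \<chi> I. cnj c * (\<Sum>J\<in>UNIV. of_real (R $ I $ J) * snd Z $ J))"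

definition isotropy_algebra :: "((complex ^ 4 ^ 4) \<times> (real ^ ('n::finite) ^ 'n) \<times> real) set" where
  "isotropy_algebra =
     {(h, r, \<theta>). adjoint_matrix h = - h \<and> trace h = 0 \<and> transpose r = - r}"

definition isotropy_var ::
  "(complex ^ 4 ^ 4) \<times> (real ^ ('n::finite) ^ 'n) \<times> real \<Rightarrow> 'n charges \<Rightarrow> 'n charges" where
  "isotropy_var w Z = (case w of (h, r, \<theta>) \<Rightarrow>
     (\<chi> A B. (h ** fst Z + fst Z ** transpose h) $ A $ B + \<i> * of_real \<theta> * fst Z $ A $ B,
      \<chi> I. (\<Sum>J\<in>UNIV. of_real (r $ I $ J) * snd Z $ J) - \<i> * of_real \<theta> * snd Z $ I))"

text \<open>
  \<open>O(6,n)\<close> and \<open>SU(1,1)\<close> act as the groups generated by their isotropy subgroup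
  (\<open>SU(4) \<times> O(n)\<close>, respectively \<open>U(1)\<close>) and their finite coset transformations.
\<close>

definition O6n_generators :: "(('n::finite) charges \<Rightarrow> 'n charges) set" where
  "O6n_generators =
     {isotropy U R 1 | U R. U \<in> SU4 \<and> orthogonal_matrix R} \<union>
     {g. \<exists>\<Xi>. (0, \<Xi>) \<in> coset_params \<and> is_coset_exp (0, \<Xi>) g}"

definition SU11_generators :: "(('n::finite) charges \<Rightarrow> 'n charges) set" where
  "SU11_generators =
     {isotropy (mat 1) (mat 1) c | c. cmod c = 1} \<union>
     {g. \<exists>\<xi>. is_coset_exp (\<xi>, 0) g}"

inductive_set generated :: "('a \<Rightarrow> 'a) set \<Rightarrow> ('a \<Rightarrow> 'a) set" for B where
  generated_id: "id \<in> generated B"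
| generated_comp: "b \<in> B \<Longrightarrow> g \<in> generated B \<Longrightarrow> b \<circ> g \<in> generated B"

definition O6n :: "(('n::finite) charges \<Rightarrow> 'n charges) set" where
  "O6n = generated O6n_generators"

definition U_duality :: "(('n::finite) charges \<Rightarrow> 'n charges) set" where
  "U_duality = generated (SU11_generators \<union> O6n_generators)"

definition invariant_under ::
  "(('n::finite) charges \<Rightarrow> 'n charges) set \<Rightarrow> ('n charges \<Rightarrow> 'b) \<Rightarrow> bool" where
  "invariant_under G F \<longleftrightarrow> (\<forall>g\<in>G. \<forall>Z\<in>charge_space. F (g Z) = F Z)"

definition eps_ZZ :: "('n::finite) charges \<Rightarrow> complex" where
  "eps_ZZ Z = (\<Sum>A\<in>UNIV. \<Sum>B\<in>UNIV. \<Sum>C\<in>UNIV. \<Sum>D\<in>UNIV.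
     eps A B C D * fst Z $ A $ B * fst Z $ C $ D)"

definition I1 :: "('n::finite) charges \<Rightarrow> real" where
  "I1 Z = 1/2 * (\<Sum>A\<in>UNIV. \<Sum>B\<in>UNIV. (cmod (fst Z $ A $ B))\<^sup>2) - (\<Sum>I\<in>UNIV. (cmod (snd Z $ I))\<^sup>2)"

definition I2 :: "('n::finite) charges \<Rightarrow> complex" where
  "I2 Z = 1/4 * eps_ZZ Z - (\<Sum>I\<in>UNIV. cnj (snd Z $ I) * cnj (snd Z $ I))"

text \<open>
  The radicand is real but negative for some charges, whence the principal complex root.
\<close>

definition S_inv :: "('n::finite) charges \<Rightarrow> complex" where
  "S_inv Z = csqrt (of_real ((I1 Z)\<^sup>2 - (cmod (I2 Z))\<^sup>2))"

definition skew_diag :: "complex \<Rightarrow> complex \<Rightarrow> complex ^ 4 ^ 4" where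
  "skew_diag z w = vector [vector [0, z, 0, 0], vector [- z, 0, 0, 0],
                           vector [0, 0, 0, w], vector [0, 0, - w, 0]]"

definition skew_eigenvalues :: "complex ^ 4 ^ 4 \<Rightarrow> complex set" where
  "skew_eigenvalues Z =
     {z. \<exists>w U. unitary_matrix U \<and> U ** Z ** transpose U = skew_diag z w}"

definition BPS_mass :: "('n::finite) charges \<Rightarrow> real" where
  "BPS_mass Z = Max (cmod ` skew_eigenvalues (fst Z))"

text \<open>
  A connected coordinate chart \<open>X\<close> of the coset space, described by a coset representative
  \<open>L \<phi>\<close>: the charges at the point \<open>\<phi>\<close> are \<open>L \<phi> Q\<close>, where \<open>Q\<close> collects the fixed electric
  and magnetic charges (\<open>2(6 + n)\<close> real numbers, written in the same complex basis).
  The derivative of \<open>L\<close> splits into the isotropy connection \<open>\<omega>\<close> and the vielbein \<open>P\<close>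
  (whose components replace \<open>\<xi>\<close> and \<open>\<xi>\<^sub>A\<^sub>B\<^sub>I\<close>), so that the covariant derivative of the charges is
  \<open>\<nabla>Z = dZ - \<omega> Z = coset_var P Z\<close>.  The vielbein identifies each tangent space with the
  coset directions.
\<close>

definition moduli_chart ::
  "('m::euclidean_space) set \<Rightarrow> ('m \<Rightarrow> ('n::finite) charges \<Rightarrow> 'n charges) \<Rightarrow>
   ('m \<Rightarrow> 'm \<Rightarrow> (complex ^ 4 ^ 4) \<times> (real ^ 'n ^ 'n) \<times> real) \<Rightarrow>
   ('m \<Rightarrow> 'm \<Rightarrow> complex \<times> (complex ^ 'n ^ 4 ^ 4)) \<Rightarrow> bool" where
  "moduli_chart X L \<omega> P \<longleftrightarrow> open X \<and> connected X \<and>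
     (\<forall>\<phi>\<in>X.
        L \<phi> \<in> U_duality \<and>
        linear (\<omega> \<phi>) \<and> range (\<omega> \<phi>) \<subseteq> isotropy_algebra \<and>
        linear (P \<phi>) \<and> bij_betw (P \<phi>) UNIV coset_params \<and>
        (\<forall>Q\<in>charge_space.
           ((\<lambda>\<psi>. L \<psi> Q) has_derivative
              (\<lambda>v. isotropy_var (\<omega> \<phi> v) (L \<phi> Q) + coset_var (P \<phi> v) (L \<phi> Q))) (at \<phi>)))"

text \<open>A stationary point of the BPS mass over the moduli space, at fixed \<open>Q\<close>.\<close>

definition attractor_point ::
  "('m::euclidean_space) set \<Rightarrow> ('m \<Rightarrow> ('n::finite) charges \<Rightarrow> 'n charges) \<Rightarrow> 'n charges \<Rightarrow> 'm \<Rightarrow> bool"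
  where
  "attractor_point X L Q \<phi> \<longleftrightarrow>
     \<phi> \<in> X \<and> ((\<lambda>\<psi>. BPS_mass (L \<psi> Q)) has_derivative (\<lambda>_. 0)) (at \<phi>)"

end

theory Submission
  imports Defs
begin

text \<open>
  Writing \<open>x = Z\<^sub>A\<^sub>B\<close> and \<open>y = cnj Z\<^sub>I\<close>, the self-dual skew matrices form a real six-dimensional subspace
  of \<open>\<Lambda>\<^sup>2 \<complex>\<^sup>4\<close>, and \<open>(x, y) = a + \<i> b\<close> for two vectors \<open>a, b\<close> of \<open>\<real>\<^sup>6\<^sup>,\<^sup>n\<close> on which \<open>O(6,n)\<close> acts
  simultaneously.  Then \<open>I1 = a \<cdot> a + b \<cdot> b\<close> and \<open>I2 = a \<cdot> a - b \<cdot> b + 2 \<i> a \<cdot> b\<close> encode the Gram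
  matrix of \<open>(a, b)\<close>, which is positive definite iff \<open>\<bar>I2\<bar> < I1\<close>.  In that case two boosts move \<open>a\<close> and
  \<open>b\<close> into the positive six-dimensional space, and the skew normal form under \<open>SU(4)\<close> shows that the Gram
  matrix separates orbits.  A polynomial invariant is therefore determined by its restriction to a slice
  that meets these orbits and on which the Gram matrix is linear up to one square.  The \<open>SU(1,1)\<close> factor acts on
  \<open>(I1, I2)\<close> as \<open>SO(1,2)\<close>, which leaves only \<open>I1\<^sup>2 - \<bar>I2\<bar>\<^sup>2\<close>.

  At a stationary point of the BPS mass, let \<open>p, q\<close> be unit vectors with \<open>Re (p\<^sup>T Z q)\<close> equal to the mass.
  Since \<open>Re (p\<^sup>T Z q)\<close> never exceeds the mass, its derivative vanishes as well; the \<open>\<xi>\<close>-directions then kill the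
  second skew-eigenvalue and the \<open>O(6,n)\<close>-directions kill \<open>Z\<^sub>I\<close>.
\<close>

section \<open>Components of skew matrices and of charges\<close>

text \<open>Orbit separation needs \<open>cmod (I2 Z) < I1 Z\<close>: the zero charge and a nonzero
  one with \<open>b = 0\<close> and \<open>a\<close> null agree in \<open>I1\<close> and
  \<open>I2\<close> but lie in different orbits. Uniqueness is therefore split into separation on
  this positive region and generation of the polynomial invariants everywhere. The second follows
  from the first because the region is open in the linear space of skew charges and a polynomial is
  determined by its germ at one point. The slice costs a square root,
  \<open>c = sqrt (b \<cdot> b)\<close>; polynomiality survives because \<open>c\<close> and
  \<open>- c\<close> have the same Gram matrix, so the odd part in \<open>c\<close> drops out. For
  U-duality the polynomial generator is the square of \<open>S_inv\<close>, as the root itself is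
  not polynomial. The BPS mass need not be smooth where skew-eigenvalues coincide. Freezing
  \<open>p, q\<close> at the stationary point gives a real-linear function of the charges that
  touches the mass from below, so no eigenvalue is ever differentiated.\<close>

lemma vector_4 [simp]:
  fixes x y z w :: "'a::zero"
  shows "(vector [x, y, z, w] :: 'a ^ 4) $ 1 = x"
    "(vector [x, y, z, w] :: 'a ^ 4) $ 2 = y"
    "(vector [x, y, z, w] :: 'a ^ 4) $ 3 = z"
    "(vector [x, y, z, w] :: 'a ^ 4) $ 4 = w"
  unfolding vector_def by simp_all

lemma det_4:
  "det (A :: 'a::comm_ring_1 ^ 4 ^ 4) =
     A$1$1 * (A$2$2 * A$3$3 * A$4$4 + A$2$3 * A$3$4 * A$4$2 + A$2$4 * A$3$2 * A$4$3
            - A$2$2 * A$3$4 * A$4$3 - A$2$3 * A$3$2 * A$4$4 - A$2$4 * A$3$3 * A$4$2)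
   - A$1$2 * (A$2$1 * A$3$3 * A$4$4 + A$2$3 * A$3$4 * A$4$1 + A$2$4 * A$3$1 * A$4$3
            - A$2$1 * A$3$4 * A$4$3 - A$2$3 * A$3$1 * A$4$4 - A$2$4 * A$3$3 * A$4$1)
   + A$1$3 * (A$2$1 * A$3$2 * A$4$4 + A$2$2 * A$3$4 * A$4$1 + A$2$4 * A$3$1 * A$4$2
            - A$2$1 * A$3$4 * A$4$2 - A$2$2 * A$3$1 * A$4$4 - A$2$4 * A$3$2 * A$4$1)
   - A$1$4 * (A$2$1 * A$3$2 * A$4$3 + A$2$2 * A$3$3 * A$4$1 + A$2$3 * A$3$1 * A$4$2
            - A$2$1 * A$3$3 * A$4$2 - A$2$2 * A$3$1 * A$4$3 - A$2$3 * A$3$2 * A$4$1)"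
proof -
  have f1: "finite {2::4, 3, 4}" "1 \<notin> {2::4, 3, 4}" by auto
  have f2: "finite {3::4, 4}" "2 \<notin> {3::4, 4}" by auto
  have f3: "finite {4::4}" "3 \<notin> {4::4}" by auto
  show ?thesis
    unfolding det_def UNIV_4
    unfolding sum_over_permutations_insert[OF f1]
    unfolding sum_over_permutations_insert[OF f2]
    unfolding sum_over_permutations_insert[OF f3]
    unfolding permutes_sing
    by (simp add: sign_swap_id permutation_swap_id permutation_compose sign_compose sign_id
        swap_id_eq algebra_simps)
qed

lemma axis_4: "axis A (1::complex) $ B = (if B = A then 1 else 0)"
  by (simp add: axis_def)

text \<open>Evaluates \<open>eps\<close> once and for all. \<open>W\<close> is not assumed skew, so
  the table also shows that contraction with \<open>eps\<close> always yields a skew matrix.\<close>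

lemma eps_sum:
  fixes W :: "complex ^ 4 ^ 4"
  shows "(\<Sum>C\<in>UNIV. \<Sum>D\<in>UNIV. eps A B C D * W $ C $ D) =
   (if A = 1 \<and> B = 2 then W$3$4 - W$4$3 else if A = 2 \<and> B = 1 then W$4$3 - W$3$4
    else if A = 1 \<and> B = 3 then W$4$2 - W$2$4 else if A = 3 \<and> B = 1 then W$2$4 - W$4$2
    else if A = 1 \<and> B = 4 then W$2$3 - W$3$2 else if A = 4 \<and> B = 1 then W$3$2 - W$2$3
    else if A = 2 \<and> B = 3 then W$1$4 - W$4$1 else if A = 3 \<and> B = 2 then W$4$1 - W$1$4
    else if A = 2 \<and> B = 4 then W$3$1 - W$1$3 else if A = 4 \<and> B = 2 then W$1$3 - W$3$1
    else if A = 3 \<and> B = 4 then W$1$2 - W$2$1 else if A = 4 \<and> B = 3 then W$2$1 - W$1$2 else 0)"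
  using exhaust_4[of A] exhaust_4[of B]
  by (elim disjE) (simp_all add: eps_def sum_4 det_4 axis_4)

text \<open>The Pfaffian of a skew 4 x 4 matrix.\<close>

definition pf :: "complex ^ 4 ^ 4 \<Rightarrow> complex" where
  "pf W = W$1$2 * W$3$4 - W$1$3 * W$2$4 + W$1$4 * W$2$3"

lemma charge_space_iff:
  "Z \<in> charge_space \<longleftrightarrow> (\<forall>A B. fst Z $ A $ B = - (fst Z $ B $ A))"
proof -
  have "Z \<in> charge_space \<longleftrightarrow> (\<forall>A B. transpose (fst Z) $ B $ A = (- fst Z) $ B $ A)"
    unfolding charge_space_def mem_Collect_eq vec_eq_iff by blast
  then show ?thesis
    by (simp only: transpose_def vec_lambda_beta vector_uminus_component)
qed

lemma coset_params_iff:
  "(\<xi>, \<Xi>) \<in> coset_params \<longleftrightarrow>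
     (\<forall>A B I. \<Xi> $ A $ B $ I = - (\<Xi> $ B $ A $ I)) \<and>
     (\<forall>A B I. cnj (\<Xi> $ A $ B $ I) =
        1/2 * (\<Sum>J\<in>UNIV. \<Sum>C\<in>UNIV. \<Sum>D\<in>UNIV. eta I J * eps A B C D * \<Xi> $ C $ D $ J))"
  unfolding coset_params_def mem_Collect_eq prod.case ..

lemma skew_4:
  fixes W :: "complex ^ 4 ^ 4"
  assumes "\<forall>A B. W $ A $ B = - (W $ B $ A)"
  shows "W$1$1 = 0" "W$2$2 = 0" "W$3$3 = 0" "W$4$4 = 0"
    "W$2$1 = - W$1$2" "W$3$1 = - W$1$3" "W$4$1 = - W$1$4"
    "W$3$2 = - W$2$3" "W$4$2 = - W$2$4" "W$4$3 = - W$3$4"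
proof -
  have "W$A$A = 0" for A
    using assms[rule_format, of A A] by simp
  then show "W$1$1 = 0" "W$2$2 = 0" "W$3$3 = 0" "W$4$4 = 0" by auto
qed (rule assms[rule_format])+

lemma I1_coords:
  assumes "Z \<in> charge_space"
  shows "I1 Z = (cmod (fst Z $ 1 $ 2))\<^sup>2 + (cmod (fst Z $ 1 $ 3))\<^sup>2 + (cmod (fst Z $ 1 $ 4))\<^sup>2
    + (cmod (fst Z $ 2 $ 3))\<^sup>2 + (cmod (fst Z $ 2 $ 4))\<^sup>2 + (cmod (fst Z $ 3 $ 4))\<^sup>2
    - (\<Sum>I\<in>UNIV. (cmod (snd Z $ I))\<^sup>2)"
  using skew_4[OF assms[unfolded charge_space_iff]] by (simp add: I1_def sum_4)

lemma eps_ZZ_coords: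
  assumes "Z \<in> charge_space"
  shows "eps_ZZ Z = 8 * pf (fst Z)"
proof -
  have "eps_ZZ Z = (\<Sum>A\<in>UNIV. \<Sum>B\<in>UNIV.
      (\<Sum>C\<in>UNIV. \<Sum>D\<in>UNIV. eps A B C D * fst Z $ C $ D) * fst Z $ A $ B)"
    by (simp add: eps_ZZ_def sum_distrib_right sum_distrib_left mult_ac)
  also have "\<dots> = 8 * pf (fst Z)"
    using skew_4[OF assms[unfolded charge_space_iff]]
    unfolding eps_sum by (simp add: sum_4 pf_def)
  finally show ?thesis .
qed

lemma I2_coords:
  assumes "Z \<in> charge_space"
  shows "I2 Z = 2 * pf (fst Z) - (\<Sum>I\<in>UNIV. cnj (snd Z $ I) * cnj (snd Z $ I))"
  by (simp add: I2_def eps_ZZ_coords[OF assms])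

lemma coset_var_coords:
  fixes Z :: "('n::finite) charges"
  assumes "Z \<in> charge_space" "(\<xi>, \<Xi>) \<in> coset_params"
  shows
    "fst (coset_var (\<xi>, \<Xi>) Z) $ 1 $ 2 = \<xi> * cnj (fst Z $ 3 $ 4) + (\<Sum>I\<in>UNIV. \<Xi>$1$2$I * cnj (snd Z $ I))"
    "fst (coset_var (\<xi>, \<Xi>) Z) $ 1 $ 3 = - \<xi> * cnj (fst Z $ 2 $ 4) + (\<Sum>I\<in>UNIV. \<Xi>$1$3$I * cnj (snd Z $ I))"
    "fst (coset_var (\<xi>, \<Xi>) Z) $ 1 $ 4 = \<xi> * cnj (fst Z $ 2 $ 3) + (\<Sum>I\<in>UNIV. \<Xi>$1$4$I * cnj (snd Z $ I))"
    "fst (coset_var (\<xi>, \<Xi>) Z) $ 2 $ 3 = \<xi> * cnj (fst Z $ 1 $ 4) + (\<Sum>I\<in>UNIV. \<Xi>$2$3$I * cnj (snd Z $ I))"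
    "fst (coset_var (\<xi>, \<Xi>) Z) $ 2 $ 4 = - \<xi> * cnj (fst Z $ 1 $ 3) + (\<Sum>I\<in>UNIV. \<Xi>$2$4$I * cnj (snd Z $ I))"
    "fst (coset_var (\<xi>, \<Xi>) Z) $ 3 $ 4 = \<xi> * cnj (fst Z $ 1 $ 2) + (\<Sum>I\<in>UNIV. \<Xi>$3$4$I * cnj (snd Z $ I))"
    "\<And>I. snd (coset_var (\<xi>, \<Xi>) Z) $ I = cnj \<xi> * cnj (snd Z $ I)
       + \<Xi>$1$2$I * cnj (fst Z $ 1 $ 2) + \<Xi>$1$3$I * cnj (fst Z $ 1 $ 3) + \<Xi>$1$4$I * cnj (fst Z $ 1 $ 4)
       + \<Xi>$2$3$I * cnj (fst Z $ 2 $ 3) + \<Xi>$2$4$I * cnj (fst Z $ 2 $ 4) + \<Xi>$3$4$I * cnj (fst Z $ 3 $ 4)"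
proof -
  note skZ = skew_4[OF assms(1)[unfolded charge_space_iff]]
  have dual: "(\<Sum>C\<in>UNIV. \<Sum>D\<in>UNIV. eps A B C D * cnj (fst Z $ C $ D)) =
     (\<Sum>C\<in>UNIV. \<Sum>D\<in>UNIV. eps A B C D * (\<chi> A B. cnj (fst Z $ A $ B)) $ C $ D)" for A B
    by simp
  have sk\<Xi>: "\<Xi> $ A $ B $ I = - (\<Xi> $ B $ A $ I)" for A B I
    using assms(2) unfolding coset_params_iff by blast
  show "fst (coset_var (\<xi>, \<Xi>) Z) $ 1 $ 2 = \<xi> * cnj (fst Z $ 3 $ 4) + (\<Sum>I\<in>UNIV. \<Xi>$1$2$I * cnj (snd Z $ I))"
    "fst (coset_var (\<xi>, \<Xi>) Z) $ 1 $ 3 = - \<xi> * cnj (fst Z $ 2 $ 4) + (\<Sum>I\<in>UNIV. \<Xi>$1$3$I * cnj (snd Z $ I))"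
    "fst (coset_var (\<xi>, \<Xi>) Z) $ 1 $ 4 = \<xi> * cnj (fst Z $ 2 $ 3) + (\<Sum>I\<in>UNIV. \<Xi>$1$4$I * cnj (snd Z $ I))"
    "fst (coset_var (\<xi>, \<Xi>) Z) $ 2 $ 3 = \<xi> * cnj (fst Z $ 1 $ 4) + (\<Sum>I\<in>UNIV. \<Xi>$2$3$I * cnj (snd Z $ I))"
    "fst (coset_var (\<xi>, \<Xi>) Z) $ 2 $ 4 = - \<xi> * cnj (fst Z $ 1 $ 3) + (\<Sum>I\<in>UNIV. \<Xi>$2$4$I * cnj (snd Z $ I))"
    "fst (coset_var (\<xi>, \<Xi>) Z) $ 3 $ 4 = \<xi> * cnj (fst Z $ 1 $ 2) + (\<Sum>I\<in>UNIV. \<Xi>$3$4$I * cnj (snd Z $ I))"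
    unfolding coset_var_def dual eps_sum by (simp_all add: skZ algebra_simps)
  fix I
  have "\<Xi>$A$A$I = 0" for A using sk\<Xi>[of A A I] by simp
  then show "snd (coset_var (\<xi>, \<Xi>) Z) $ I = cnj \<xi> * cnj (snd Z $ I)
       + \<Xi>$1$2$I * cnj (fst Z $ 1 $ 2) + \<Xi>$1$3$I * cnj (fst Z $ 1 $ 3) + \<Xi>$1$4$I * cnj (fst Z $ 1 $ 4)
       + \<Xi>$2$3$I * cnj (fst Z $ 2 $ 3) + \<Xi>$2$4$I * cnj (fst Z $ 2 $ 4) + \<Xi>$3$4$I * cnj (fst Z $ 3 $ 4)"
    using skZ sk\<Xi>[of 2 1 I] sk\<Xi>[of 3 1 I] sk\<Xi>[of 4 1 I] sk\<Xi>[of 3 2 I] sk\<Xi>[of 4 2 I] sk\<Xi>[of 4 3 I]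
    by (simp add: coset_var_def eta_def sum_4 if_distrib[of "\<lambda>x. x * _"] cong: if_cong)
qed

lemma coset_params_real:
  assumes "(\<xi>, \<Xi>) \<in> coset_params"
  shows "cnj (\<Xi>$1$2$I) = \<Xi>$3$4$I" "cnj (\<Xi>$1$3$I) = - \<Xi>$2$4$I" "cnj (\<Xi>$1$4$I) = \<Xi>$2$3$I"
    "cnj (\<Xi>$2$3$I) = \<Xi>$1$4$I" "cnj (\<Xi>$2$4$I) = - \<Xi>$1$3$I" "cnj (\<Xi>$3$4$I) = \<Xi>$1$2$I"
proof -
  have sk\<Xi>: "\<Xi> $ A $ B $ I = - (\<Xi> $ B $ A $ I)" for A B I
    using assms unfolding coset_params_iff by blast
  have "cnj (\<Xi> $ A $ B $ I) = 1/2 * (\<Sum>C\<in>UNIV. \<Sum>D\<in>UNIV. eps A B C D * (\<chi> C D. \<Xi> $ C $ D $ I) $ C $ D)" for A B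
  proof -
    have "cnj (\<Xi> $ A $ B $ I) =
        1/2 * (\<Sum>J\<in>UNIV. \<Sum>C\<in>UNIV. \<Sum>D\<in>UNIV. eta I J * eps A B C D * \<Xi> $ C $ D $ J)"
      using assms unfolding coset_params_iff by blast
    also have "(\<Sum>J\<in>UNIV. \<Sum>C\<in>UNIV. \<Sum>D\<in>UNIV. eta I J * eps A B C D * \<Xi> $ C $ D $ J)
       = (\<Sum>J\<in>UNIV. if I = J then (\<Sum>C\<in>UNIV. \<Sum>D\<in>UNIV. eps A B C D * \<Xi> $ C $ D $ J) else 0)"
      by (intro sum.cong) (auto simp: eta_def)
    finally show ?thesis by simp
  qed
  note r = this[unfolded eps_sum]
  show "cnj (\<Xi>$1$2$I) = \<Xi>$3$4$I" "cnj (\<Xi>$1$3$I) = - \<Xi>$2$4$I" "cnj (\<Xi>$1$4$I) = \<Xi>$2$3$I"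
    "cnj (\<Xi>$2$3$I) = \<Xi>$1$4$I" "cnj (\<Xi>$2$4$I) = - \<Xi>$1$3$I" "cnj (\<Xi>$3$4$I) = \<Xi>$1$2$I"
    using r[of 1 2] r[of 1 3] r[of 1 4] r[of 2 3] r[of 2 4] r[of 3 4]
      sk\<Xi>[of 2 1 I] sk\<Xi>[of 3 1 I] sk\<Xi>[of 4 1 I] sk\<Xi>[of 3 2 I] sk\<Xi>[of 4 2 I] sk\<Xi>[of 4 3 I]
    by simp_all
qed

lemma coset_var_in_charge_space:
  assumes "p \<in> coset_params"
  shows "coset_var p Z \<in> charge_space"
proof -
  obtain \<xi> \<Xi> where p: "p = (\<xi>, \<Xi>)" by fastforce
  have sk\<Xi>: "\<Xi> $ A $ B $ I = - (\<Xi> $ B $ A $ I)" for A B I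
    using assms unfolding coset_params_iff p by blast
  have dual: "(\<Sum>C\<in>UNIV. \<Sum>D\<in>UNIV. eps A B C D * cnj (fst Z $ C $ D)) =
     (\<Sum>C\<in>UNIV. \<Sum>D\<in>UNIV. eps A B C D * (\<chi> A B. cnj (fst Z $ A $ B)) $ C $ D)" for A B
    by simp
  have 1: "(\<Sum>C\<in>UNIV. \<Sum>D\<in>UNIV. eps A B C D * cnj (fst Z $ C $ D)) =
    - (\<Sum>C\<in>UNIV. \<Sum>D\<in>UNIV. eps B A C D * cnj (fst Z $ C $ D))" for A B
    unfolding dual eps_sum using exhaust_4[of A] exhaust_4[of B] by (elim disjE) simp_all
  have 2: "(\<Sum>I\<in>UNIV. \<Xi>$A$B$I * cnj (snd Z $ I)) = - (\<Sum>I\<in>UNIV. \<Xi>$B$A$I * cnj (snd Z $ I))" for A B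
    unfolding sum_negf[symmetric] by (intro sum.cong) (use sk\<Xi>[of A B] in auto)
  have "1/2 * \<xi> * (\<Sum>C\<in>UNIV. \<Sum>D\<in>UNIV. eps A B C D * cnj (fst Z $ C $ D)) + (\<Sum>I\<in>UNIV. \<Xi>$A$B$I * cnj (snd Z $ I))
     = - (1/2 * \<xi> * (\<Sum>C\<in>UNIV. \<Sum>D\<in>UNIV. eps B A C D * cnj (fst Z $ C $ D)) + (\<Sum>I\<in>UNIV. \<Xi>$B$A$I * cnj (snd Z $ I)))" for A B
    unfolding 1[of A B] 2[of A B] by (simp only: minus_add_distrib mult_minus_right)
  then show ?thesis
    unfolding charge_space_iff p coset_var_def prod.case fst_conv vec_lambda_beta by blast
qed

section \<open>Invariance of \<open>I1\<close>, \<open>I2\<close> and \<open>I1\<^sup>2 - \<bar>I2\<bar>\<^sup>2\<close>\<close>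

text \<open>The left-hand side is the derivative of \<open>I2\<close> in the direction
  \<open>d\<close>, in the shape the product rule delivers. The \<open>\<Xi>\<close>-terms of the
  Pfaffian and of the matter part cancel by the reality condition.\<close>

lemma coset_flow_I2_rate:
  fixes Z :: "('n::finite) charges"
  assumes "Z \<in> charge_space" "(\<xi>, \<Xi>) \<in> coset_params"
  defines "d \<equiv> coset_var (\<xi>, \<Xi>) Z"
  shows "2 * (fst Z$1$2 * fst d$3$4 + fst d$1$2 * fst Z$3$4 - (fst Z$1$3 * fst d$2$4 + fst d$1$3 * fst Z$2$4)
      + (fst Z$1$4 * fst d$2$3 + fst d$1$4 * fst Z$2$3))
    - (\<Sum>I\<in>UNIV. cnj (snd Z $ I) * cnj (snd d $ I) + cnj (snd d $ I) * cnj (snd Z $ I))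
    = 2 * \<xi> * of_real (I1 Z)"
  unfolding d_def I1_coords[OF assms(1)] coset_var_coords[OF assms(1,2)]
  by (simp add: coset_params_real[OF assms(2)] complex_norm_square sum.distrib sum_subtractf sum_distrib_left
      sum_distrib_right algebra_simps del: of_real_power)

lemma coset_flow_I1_rate:
  fixes Z :: "('n::finite) charges"
  assumes "Z \<in> charge_space" "(\<xi>, \<Xi>) \<in> coset_params"
  defines "d \<equiv> coset_var (\<xi>, \<Xi>) Z"
  shows "fst Z$1$2 * cnj (fst d$1$2) + fst d$1$2 * cnj (fst Z$1$2)
      + (fst Z$1$3 * cnj (fst d$1$3) + fst d$1$3 * cnj (fst Z$1$3))
      + (fst Z$1$4 * cnj (fst d$1$4) + fst d$1$4 * cnj (fst Z$1$4))
      + (fst Z$2$3 * cnj (fst d$2$3) + fst d$2$3 * cnj (fst Z$2$3))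
      + (fst Z$2$4 * cnj (fst d$2$4) + fst d$2$4 * cnj (fst Z$2$4))
      + (fst Z$3$4 * cnj (fst d$3$4) + fst d$3$4 * cnj (fst Z$3$4))
    - (\<Sum>I\<in>UNIV. snd Z $ I * cnj (snd d $ I) + snd d $ I * cnj (snd Z $ I))
    = \<xi> * cnj (I2 Z) + cnj \<xi> * I2 Z"
  unfolding d_def I2_coords[OF assms(1)] coset_var_coords[OF assms(1,2)]
  by (simp add: coset_params_real[OF assms(2)] pf_def sum_negf sum.distrib sum_subtractf sum_distrib_left
      sum_distrib_right algebra_simps del: of_real_power)

lemma bounded_linear_charges_nth:
  "bounded_linear (\<lambda>Z :: ('n::finite) charges. fst Z $ A $ B)"
  "bounded_linear (\<lambda>Z :: ('n::finite) charges. snd Z $ I)"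
proof -
  show "bounded_linear (\<lambda>Z :: 'n charges. fst Z $ A $ B)"
    by (intro bounded_linear_compose[OF bounded_linear_vec_nth] bounded_linear_fst)
  show "bounded_linear (\<lambda>Z :: 'n charges. snd Z $ I)"
    by (intro bounded_linear_compose[OF bounded_linear_vec_nth] bounded_linear_snd)
qed

lemmas has_vector_derivative_charges_nth = bounded_linear_charges_nth[THEN bounded_linear.has_vector_derivative]

text \<open>\<open>I1\<close> is lifted to the complex numbers so that squared moduli become
  products with \<open>cnj\<close>, to which the product rule applies.\<close>

lemma coset_flow_derivatives:
  fixes \<gamma> :: "real \<Rightarrow> ('n::finite) charges"
  assumes p: "(\<xi>, \<Xi>) \<in> coset_params" and t: "t \<in> S"
    and cs: "\<And>s. s \<in> S \<Longrightarrow> \<gamma> s \<in> charge_space"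
    and d: "(\<gamma> has_vector_derivative coset_var (\<xi>, \<Xi>) (\<gamma> t)) (at t within S)"
  shows "((\<lambda>s. I2 (\<gamma> s)) has_vector_derivative 2 * \<xi> * of_real (I1 (\<gamma> t))) (at t within S)"
    "((\<lambda>s. complex_of_real (I1 (\<gamma> s))) has_vector_derivative
       \<xi> * cnj (I2 (\<gamma> t)) + cnj \<xi> * I2 (\<gamma> t)) (at t within S)"
proof -
  note D = has_vector_derivative_charges_nth[OF d]
  have "((\<lambda>s. 2 * pf (fst (\<gamma> s)) - (\<Sum>I\<in>UNIV. cnj (snd (\<gamma> s) $ I) * cnj (snd (\<gamma> s) $ I)))
      has_vector_derivative 2 * \<xi> * of_real (I1 (\<gamma> t))) (at t within S)"
    unfolding coset_flow_I2_rate[OF cs[OF t] p, symmetric] pf_def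
    by (intro has_vector_derivative_diff has_vector_derivative_sum has_vector_derivative_mult_right
        has_vector_derivative_add has_vector_derivative_mult has_vector_derivative_cnj D)
  then show "((\<lambda>s. I2 (\<gamma> s)) has_vector_derivative 2 * \<xi> * of_real (I1 (\<gamma> t))) (at t within S)"
    by (rule has_vector_derivative_transform[OF t, rotated]) (simp add: I2_coords[OF cs])
  have "((\<lambda>s. fst (\<gamma> s)$1$2 * cnj (fst (\<gamma> s)$1$2) + fst (\<gamma> s)$1$3 * cnj (fst (\<gamma> s)$1$3)
      + fst (\<gamma> s)$1$4 * cnj (fst (\<gamma> s)$1$4) + fst (\<gamma> s)$2$3 * cnj (fst (\<gamma> s)$2$3)
      + fst (\<gamma> s)$2$4 * cnj (fst (\<gamma> s)$2$4) + fst (\<gamma> s)$3$4 * cnj (fst (\<gamma> s)$3$4)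
      - (\<Sum>I\<in>UNIV. snd (\<gamma> s) $ I * cnj (snd (\<gamma> s) $ I))) has_vector_derivative
       \<xi> * cnj (I2 (\<gamma> t)) + cnj \<xi> * I2 (\<gamma> t)) (at t within S)"
    unfolding coset_flow_I1_rate[OF cs[OF t] p, symmetric]
    by (intro has_vector_derivative_diff has_vector_derivative_sum has_vector_derivative_mult_right
        has_vector_derivative_add has_vector_derivative_mult has_vector_derivative_cnj D)
  then show "((\<lambda>s. complex_of_real (I1 (\<gamma> s))) has_vector_derivative
       \<xi> * cnj (I2 (\<gamma> t)) + cnj \<xi> * I2 (\<gamma> t)) (at t within S)"
    by (rule has_vector_derivative_transform[OF t, rotated]) (simp add: I1_coords[OF cs] complex_norm_square del: of_real_power)
qed

lemma zero_derivative_imp_constant: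
  fixes f :: "real \<Rightarrow> 'a::real_normed_vector"
  assumes "\<And>t. t \<in> {0..1} \<Longrightarrow> (f has_vector_derivative 0) (at t within {0..1})" and t: "t \<in> {0..1}"
  shows "f t = f 0"
proof -
  obtain c where c: "\<And>t. t \<in> {0..1} \<Longrightarrow> f t = c"
    by (rule has_vector_derivative_zero_constant[of "{0..1}" f]) (use assms in auto)
  show ?thesis using c[OF t] c[of 0] by simp
qed

text \<open>\<open>coset_var p\<close> takes skew values even off \<open>charge_space\<close>, so
  the symmetric part of the curve has derivative zero. This has to precede the rates of
  \<open>I1\<close> and \<open>I2\<close>, which hold for skew charges.\<close>

lemma coset_flow_charge_space:
  fixes \<gamma> :: "real \<Rightarrow> ('n::finite) charges"
  assumes p: "p \<in> coset_params" and 0: "\<gamma> 0 \<in> charge_space"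
    and d: "\<forall>t\<in>{0..1}. (\<gamma> has_vector_derivative coset_var p (\<gamma> t)) (at t within {0..1})"
    and t: "t \<in> {0..1}"
  shows "\<gamma> t \<in> charge_space"
  unfolding charge_space_iff
proof (intro allI)
  fix A B
  have "((\<lambda>s. fst (\<gamma> s) $ A $ B + fst (\<gamma> s) $ B $ A) has_vector_derivative 0) (at t within {0..1})"
    if "t \<in> {0..1}" for t
  proof -
    have "fst (coset_var p (\<gamma> t)) $ A $ B = - (fst (coset_var p (\<gamma> t)) $ B $ A)"
      using coset_var_in_charge_space[OF p] unfolding charge_space_iff by blast
    moreover note D = has_vector_derivative_charges_nth(1)[OF d[rule_format, OF that]]
    ultimately show ?thesis
      using has_vector_derivative_add[OF D[of A B] D[of B A]] by simp
  qed
  from zero_derivative_imp_constant[OF this t]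
  have "fst (\<gamma> t) $ A $ B + fst (\<gamma> t) $ B $ A = fst (\<gamma> 0) $ A $ B + fst (\<gamma> 0) $ B $ A" .
  moreover have "fst (\<gamma> 0) $ A $ B = - (fst (\<gamma> 0) $ B $ A)"
    using 0 unfolding charge_space_iff by blast
  ultimately show "fst (\<gamma> t) $ A $ B = - (fst (\<gamma> t) $ B $ A)"
    by (simp add: eq_neg_iff_add_eq_0)
qed

lemma coset_exp_charge_space:
  assumes "p \<in> coset_params" "is_coset_exp p g" "Z \<in> charge_space"
  shows "g Z \<in> charge_space"
proof -
  obtain \<gamma> where "\<gamma> 0 = Z" "\<gamma> 1 = g Z"
    "\<forall>t\<in>{0..1}. (\<gamma> has_vector_derivative coset_var p (\<gamma> t)) (at t within {0..1})"
    using assms unfolding is_coset_exp_def by blast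
  then show ?thesis
    using coset_flow_charge_space[of p \<gamma> 1] assms by auto
qed

text \<open>Along the flow \<open>I2' = 2 \<xi> I1\<close> and \<open>I1' = 2 Re (\<xi> cnj I2)\<close>, which leaves
  \<open>I1\<^sup>2 - \<bar>I2\<bar>\<^sup>2\<close> constant.\<close>

definition disc :: "('n::finite) charges \<Rightarrow> real" where
  "disc Z = (I1 Z)\<^sup>2 - (cmod (I2 Z))\<^sup>2"

lemma coset_exp_invariants:
  fixes Z :: "('n::finite) charges"
  assumes p: "(\<xi>, \<Xi>) \<in> coset_params" and g: "is_coset_exp (\<xi>, \<Xi>) g" and Z: "Z \<in> charge_space"
  shows "disc (g Z) = disc Z"
    "\<xi> = 0 \<Longrightarrow> I1 (g Z) = I1 Z" "\<xi> = 0 \<Longrightarrow> I2 (g Z) = I2 Z"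
proof -
  obtain \<gamma> where \<gamma>: "\<gamma> 0 = Z" "\<gamma> 1 = g Z"
    and d: "\<forall>t\<in>{0..1}. (\<gamma> has_vector_derivative coset_var (\<xi>, \<Xi>) (\<gamma> t)) (at t within {0..1})"
    using g Z unfolding is_coset_exp_def by blast
  have cs: "\<gamma> t \<in> charge_space" if "t \<in> {0..1}" for t
    using coset_flow_charge_space[OF p _ d that] \<gamma> Z by simp
  note D = coset_flow_derivatives[OF p _ cs d[rule_format]]
  have const: "f 1 = f 0" if "\<And>t. t \<in> {0..1} \<Longrightarrow> (f has_vector_derivative 0) (at t within {0..1})"
    for f :: "real \<Rightarrow> complex"
    by (rule zero_derivative_imp_constant[OF that]) auto
  \<comment> \<open>The discriminant as a polynomial in \<open>I1\<close>, \<open>I2\<close> and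
    \<open>cnj I2\<close>; the derivatives of its two terms cancel.\<close>
  let ?f = "\<lambda>t. complex_of_real (I1 (\<gamma> t)) * complex_of_real (I1 (\<gamma> t)) - I2 (\<gamma> t) * cnj (I2 (\<gamma> t))"
  have eq: "?f 1 = ?f 0"
  proof (rule const)
    fix t :: real assume t: "t \<in> {0..1}"
    have "(?f has_vector_derivative of_real (I1 (\<gamma> t)) * (\<xi> * cnj (I2 (\<gamma> t)) + cnj \<xi> * I2 (\<gamma> t))
        + (\<xi> * cnj (I2 (\<gamma> t)) + cnj \<xi> * I2 (\<gamma> t)) * of_real (I1 (\<gamma> t))
        - (I2 (\<gamma> t) * cnj (2 * \<xi> * of_real (I1 (\<gamma> t))) + 2 * \<xi> * of_real (I1 (\<gamma> t)) * cnj (I2 (\<gamma> t)))) (at t within {0..1})"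
      by (intro has_vector_derivative_diff has_vector_derivative_mult has_vector_derivative_cnj D t)
    then show "(?f has_vector_derivative 0) (at t within {0..1})"
      by (simp add: algebra_simps)
  qed
  have "?f t = of_real (disc (\<gamma> t))" for t
    unfolding disc_def of_real_diff complex_norm_square by (simp add: power2_eq_square)
  with eq show "disc (g Z) = disc Z"
    by (metis \<gamma> of_real_eq_iff)
  assume [simp]: "\<xi> = 0"
  show "I1 (g Z) = I1 Z"
    using const[of "\<lambda>t. of_real (I1 (\<gamma> t))"] D(2) by (simp add: \<gamma>)
  show "I2 (g Z) = I2 Z"
    using const[of "\<lambda>t. I2 (\<gamma> t)"] D(1) by (simp add: \<gamma>)
qed

section \<open>Action of the isotropy group\<close>

lemma congruence_skew:
  fixes U W :: "complex ^ 4 ^ 4"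
  assumes "\<forall>A B. W $ A $ B = - (W $ B $ A)"
  shows "(U ** W ** transpose U) $ A $ B =
      W$1$2 * (U$A$1 * U$B$2 - U$A$2 * U$B$1) + W$1$3 * (U$A$1 * U$B$3 - U$A$3 * U$B$1)
    + W$1$4 * (U$A$1 * U$B$4 - U$A$4 * U$B$1) + W$2$3 * (U$A$2 * U$B$3 - U$A$3 * U$B$2)
    + W$2$4 * (U$A$2 * U$B$4 - U$A$4 * U$B$2) + W$3$4 * (U$A$3 * U$B$4 - U$A$4 * U$B$3)"
  using skew_4[OF assms]
  by (simp add: matrix_matrix_mult_def transpose_def sum_4 algebra_simps)

lemma congruence_skew_skew:
  fixes U W :: "complex ^ 4 ^ 4"
  assumes "\<forall>A B. W $ A $ B = - (W $ B $ A)"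
  shows "\<forall>A B. (U ** W ** transpose U) $ A $ B = - ((U ** W ** transpose U) $ B $ A)"
  unfolding congruence_skew[OF assms] by (simp add: algebra_simps)

text \<open>This is where SU(4) differs from U(4): \<open>I1\<close> is preserved by all unitary
  congruences, \<open>I2\<close> only by those of determinant one.\<close>

lemma pf_congruence:
  fixes U W :: "complex ^ 4 ^ 4"
  assumes "\<forall>A B. W $ A $ B = - (W $ B $ A)"
  shows "pf (U ** W ** transpose U) = det U * pf W"
  unfolding pf_def congruence_skew[OF assms] det_4
  by algebra

lemma unitary_cmod_sum:
  assumes "unitary_matrix U"
  shows "(\<Sum>A\<in>UNIV. (cmod (\<Sum>C\<in>UNIV. U $ A $ C * f C))\<^sup>2) = (\<Sum>C\<in>UNIV. (cmod (f C))\<^sup>2)"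
proof -
  have 1: "(\<Sum>A\<in>UNIV. cnj (U $ A $ D) * U $ A $ C) = (if D = C then 1 else 0)" for C D
    using assms unfolding unitary_matrix_def adjoint_matrix_def
    by (auto simp: vec_eq_iff matrix_matrix_mult_def mat_def)
  have "complex_of_real (\<Sum>A\<in>UNIV. (cmod (\<Sum>C\<in>UNIV. U $ A $ C * f C))\<^sup>2)
     = (\<Sum>A\<in>UNIV. \<Sum>C\<in>UNIV. \<Sum>D\<in>UNIV. (cnj (U $ A $ D) * U $ A $ C) * (cnj (f D) * f C))"
    by (simp add: complex_norm_square sum_product mult_ac del: of_real_power)
  also have "\<dots> = (\<Sum>C\<in>UNIV. \<Sum>D\<in>UNIV. (\<Sum>A\<in>UNIV. cnj (U $ A $ D) * U $ A $ C) * (cnj (f D) * f C))"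
    by (subst sum.swap, rule sum.cong[OF refl], subst sum.swap) (simp add: sum_distrib_right)
  also have "\<dots> = complex_of_real (\<Sum>C\<in>UNIV. (cmod (f C))\<^sup>2)"
    unfolding 1
    by (simp add: complex_norm_square if_distrib[of "\<lambda>x. x * _"] if_distrib[of "(*) a" for a] mult.commute del: of_real_power cong: if_cong)
  finally show ?thesis by (simp only: of_real_eq_iff)
qed

lemma unitary_congruence_cmod_sum:
  assumes "unitary_matrix U"
  shows "(\<Sum>A\<in>UNIV. \<Sum>B\<in>UNIV. (cmod ((U ** W ** transpose U) $ A $ B))\<^sup>2)
     = (\<Sum>A\<in>UNIV. \<Sum>B\<in>UNIV. (cmod (W $ A $ B))\<^sup>2)"
proof -
  have e: "(U ** W ** transpose U) $ A $ B = (\<Sum>D\<in>UNIV. U $ B $ D * (U ** W) $ A $ D)" for A B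
    by (simp add: matrix_matrix_mult_def[of "U ** W"] transpose_def mult.commute)
  have e2: "(U ** W) $ A $ D = (\<Sum>C\<in>UNIV. U $ A $ C * W $ C $ D)" for A D
    by (simp add: matrix_matrix_mult_def)
  have "(\<Sum>A\<in>UNIV. \<Sum>B\<in>UNIV. (cmod ((U ** W ** transpose U) $ A $ B))\<^sup>2)
     = (\<Sum>A\<in>UNIV. \<Sum>D\<in>UNIV. (cmod ((U ** W) $ A $ D))\<^sup>2)"
    unfolding e unitary_cmod_sum[OF assms] ..
  also have "\<dots> = (\<Sum>D\<in>UNIV. \<Sum>A\<in>UNIV. (cmod (W $ A $ D))\<^sup>2)"
    unfolding e2 by (subst sum.swap) (simp only: unitary_cmod_sum[OF assms])
  also have "\<dots> = (\<Sum>A\<in>UNIV. \<Sum>D\<in>UNIV. (cmod (W $ A $ D))\<^sup>2)"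
    by (rule sum.swap)
  finally show ?thesis .
qed

text \<open>Bilinear with independent \<open>f\<close> and \<open>g\<close>, so that it serves
  \<open>I1\<close> (with \<open>g\<close> the conjugate of \<open>f\<close>) as well as
  \<open>I2\<close> (with \<open>f = g\<close>).\<close>

lemma orthogonal_matrix_sum:
  fixes R :: "real ^ ('n::finite) ^ 'n" and f g :: "'n \<Rightarrow> complex"
  assumes "orthogonal_matrix R"
  shows "(\<Sum>I\<in>UNIV. (\<Sum>J\<in>UNIV. of_real (R $ I $ J) * f J) * (\<Sum>J\<in>UNIV. of_real (R $ I $ J) * g J))
    = (\<Sum>I\<in>UNIV. f I * g I)"
proof -
  have 1: "(\<Sum>I\<in>UNIV. R $ I $ J * R $ I $ K) = (if J = K then 1 else 0)" for J K
  proof -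
    have "(\<Sum>I\<in>UNIV. R $ I $ J * R $ I $ K) = (transpose R ** R) $ J $ K"
      by (simp add: transpose_def matrix_matrix_mult_def)
    also have "\<dots> = (if J = K then 1 else 0)"
      using assms by (simp add: orthogonal_matrix_def mat_def)
    finally show ?thesis .
  qed
  have "(\<Sum>I\<in>UNIV. (\<Sum>J\<in>UNIV. of_real (R $ I $ J) * f J) * (\<Sum>J\<in>UNIV. of_real (R $ I $ J) * g J))
     = (\<Sum>I\<in>UNIV. \<Sum>J\<in>UNIV. \<Sum>K\<in>UNIV. of_real (R $ I $ J * R $ I $ K) * (f J * g K))"
    by (simp add: sum_product mult_ac)
  also have "\<dots> = (\<Sum>J\<in>UNIV. \<Sum>K\<in>UNIV. of_real (\<Sum>I\<in>UNIV. R $ I $ J * R $ I $ K) * (f J * g K))"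
    by (subst sum.swap, rule sum.cong[OF refl], subst sum.swap) (simp add: sum_distrib_right)
  also have "\<dots> = (\<Sum>I\<in>UNIV. f I * g I)"
    unfolding 1 by (simp add: if_distrib[of complex_of_real] if_distrib[of "\<lambda>x. x * _"] cong: if_cong)
  finally show ?thesis .
qed

lemma isotropy_charge_space:
  assumes "Z \<in> charge_space"
  shows "isotropy U R c Z \<in> charge_space"
proof -
  have "(U ** fst Z ** transpose U) $ A $ B = - ((U ** fst Z ** transpose U) $ B $ A)" for A B
    using congruence_skew_skew[OF assms[unfolded charge_space_iff]] by blast
  then have "c * (U ** fst Z ** transpose U) $ A $ B = - (c * (U ** fst Z ** transpose U) $ B $ A)" for A B
    by (metis mult_minus_right)
  then show ?thesis
    unfolding charge_space_iff isotropy_def fst_conv vec_lambda_beta by blast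
qed

lemma isotropy_I1:
  assumes "unitary_matrix U" "orthogonal_matrix R" "cmod c = 1"
  shows "I1 (isotropy U R c Z) = I1 Z"
proof -
  have "complex_of_real (\<Sum>I\<in>UNIV. (cmod (\<Sum>J\<in>UNIV. of_real (R $ I $ J) * snd Z $ J))\<^sup>2)
     = complex_of_real (\<Sum>I\<in>UNIV. (cmod (snd Z $ I))\<^sup>2)"
    using orthogonal_matrix_sum[OF assms(2), of "\<lambda>J. snd Z $ J" "\<lambda>J. cnj (snd Z $ J)"]
    by (simp add: complex_norm_square del: of_real_power)
  then have "(\<Sum>I\<in>UNIV. (cmod (\<Sum>J\<in>UNIV. of_real (R $ I $ J) * snd Z $ J))\<^sup>2)
     = (\<Sum>I\<in>UNIV. (cmod (snd Z $ I))\<^sup>2)"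
    by (simp only: of_real_eq_iff)
  then show ?thesis
    using unitary_congruence_cmod_sum[OF assms(1), of "fst Z"] assms(3)
    by (simp add: I1_def isotropy_def norm_mult)
qed

text \<open>The Pfaffian is quadratic in \<open>c\<close>. The matter charges carry the opposite
  weight, but they enter \<open>I2\<close> conjugated, so both terms rotate by the same
  phase.\<close>

lemma isotropy_I2:
  assumes Z: "Z \<in> charge_space" and "det U = 1" "orthogonal_matrix R" "cmod c = 1"
  shows "I2 (isotropy U R c Z) = c\<^sup>2 * I2 Z"
proof -
  have "pf (fst (isotropy U R c Z)) = c\<^sup>2 * pf (U ** fst Z ** transpose U)"
    by (simp add: isotropy_def pf_def power2_eq_square algebra_simps)
  also have "\<dots> = c\<^sup>2 * pf (fst Z)"
    by (simp add: pf_congruence[OF Z[unfolded charge_space_iff]] assms)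
  finally have pf: "pf (fst (isotropy U R c Z)) = c\<^sup>2 * pf (fst Z)" .
  let ?S = "\<lambda>I. \<Sum>J\<in>UNIV. of_real (R $ I $ J) * cnj (snd Z $ J)"
  have "(\<Sum>I\<in>UNIV. cnj (snd (isotropy U R c Z) $ I) * cnj (snd (isotropy U R c Z) $ I))
     = (\<Sum>I\<in>UNIV. c\<^sup>2 * (?S I * ?S I))"
    by (intro sum.cong refl) (simp add: isotropy_def power2_eq_square)
  also have "\<dots> = c\<^sup>2 * (\<Sum>I\<in>UNIV. cnj (snd Z $ I) * cnj (snd Z $ I))"
    by (simp only: sum_distrib_left[symmetric] orthogonal_matrix_sum[OF assms(3)])
  finally show ?thesis
    by (simp add: I2_coords[OF Z] I2_coords[OF isotropy_charge_space[OF Z]] pf algebra_simps)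
qed

section \<open>From generators to the generated groups\<close>

lemma generated_induct_on:
  assumes "g \<in> generated B" "x \<in> S"
    and "\<And>b x. b \<in> B \<Longrightarrow> x \<in> S \<Longrightarrow> b x \<in> S \<and> f (b x) = f x"
  shows "g x \<in> S \<and> f (g x) = f x"
  using assms(1) by induction (use assms(2,3) in auto)

lemma zero_Xi_in_coset_params: "(\<xi>, 0) \<in> coset_params"
  unfolding coset_params_iff by simp

lemma unitary_mat_1 [simp]: "unitary_matrix (mat 1)"
  by (simp add: unitary_matrix_def adjoint_matrix_def vec_eq_iff mat_def matrix_matrix_mult_def
      if_distrib[of "\<lambda>x. x * _"] if_distrib[of cnj] cong: if_cong)

lemma O6n_generators_invariants:
  fixes g :: "('n::finite) charges \<Rightarrow> 'n charges"
  assumes g: "g \<in> O6n_generators" and Z: "Z \<in> charge_space"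
  shows "g Z \<in> charge_space \<and> (I1 (g Z), I2 (g Z)) = (I1 Z, I2 Z)"
  using g[unfolded O6n_generators_def]
proof
  assume "g \<in> {isotropy U R 1 |U R. U \<in> SU4 \<and> orthogonal_matrix R}"
  then obtain U R where "g = isotropy U R 1" "U \<in> SU4" "orthogonal_matrix R" by blast
  then show ?thesis
    using isotropy_charge_space[OF Z, of U R 1] isotropy_I1[of U R 1 Z] isotropy_I2[OF Z, of U R 1]
    by (simp add: SU4_def)
next
  assume "g \<in> {g. \<exists>\<Xi>. (0, \<Xi>) \<in> coset_params \<and> is_coset_exp (0, \<Xi>) g}"
  then obtain \<Xi> where "(0, \<Xi>) \<in> coset_params" "is_coset_exp (0, \<Xi>) g" by blast
  then show ?thesis
    using coset_exp_charge_space[OF _ _ Z] coset_exp_invariants[OF _ _ Z] by simp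
qed

lemma O6n_invariants:
  assumes "g \<in> O6n" and "Z \<in> charge_space"
  shows "g Z \<in> charge_space" "I1 (g Z) = I1 Z" "I2 (g Z) = I2 Z"
  using generated_induct_on[OF assms[unfolded O6n_def], of "\<lambda>Z. (I1 Z, I2 Z)"]
    O6n_generators_invariants by auto

lemma U_duality_invariants:
  fixes g :: "('n::finite) charges \<Rightarrow> 'n charges"
  assumes "g \<in> U_duality" and "Z \<in> charge_space"
  shows "g Z \<in> charge_space" "disc (g Z) = disc Z"
proof -
  have "b Z \<in> charge_space \<and> disc (b Z) = disc Z"
    if b: "b \<in> SU11_generators \<union> O6n_generators" and Z: "Z \<in> charge_space" for b and Z :: "'n charges"
    using b
  proof
    assume "b \<in> SU11_generators"
    then consider c where "b = isotropy (mat 1) (mat 1) c" "cmod c = 1" | \<xi> where "is_coset_exp (\<xi>, 0) b"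
      unfolding SU11_generators_def by blast
    then show ?thesis
    proof cases
      case 1
      then show ?thesis
        using isotropy_charge_space[OF Z, of "mat 1" "mat 1" c] isotropy_I1[of "mat 1" "mat 1" c Z]
          isotropy_I2[OF Z, of "mat 1" "mat 1" c]
        by (simp add: disc_def orthogonal_matrix_id norm_mult norm_power)
    next
      case 2
      then show ?thesis
        using coset_exp_charge_space[OF zero_Xi_in_coset_params _ Z]
          coset_exp_invariants(1)[OF zero_Xi_in_coset_params _ Z] by simp
    qed
  next
    assume "b \<in> O6n_generators"
    then show ?thesis using O6n_generators_invariants[OF _ Z] by (auto simp: disc_def)
  qed
  then have "g Z \<in> charge_space \<and> disc (g Z) = disc Z"
    by (rule generated_induct_on[OF assms[unfolded U_duality_def], of disc])
  then show "g Z \<in> charge_space" "disc (g Z) = disc Z" by auto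
qed

lemma generated_mono: "A \<subseteq> B \<Longrightarrow> g \<in> generated A \<Longrightarrow> g \<in> generated B"
  by (rotate_tac, induction rule: generated.induct) (auto intro: generated.intros)

lemma O6n_subset_U_duality: "O6n \<subseteq> U_duality"
  unfolding O6n_def U_duality_def using generated_mono by blast

lemma S_inv_eq: "S_inv Z = csqrt (of_real (disc Z))"
  by (simp add: S_inv_def disc_def)

section \<open>Unitary normal form and BPS mass\<close>

definition bform :: "complex ^ 4 ^ 4 \<Rightarrow> complex ^ 4 \<Rightarrow> complex ^ 4 \<Rightarrow> complex" where
  "bform Z p q = (\<Sum>A\<in>UNIV. \<Sum>B\<in>UNIV. Z $ A $ B * p $ A * q $ B)"

lemma congruence_eq_bform: "(U ** Z ** transpose U) $ A $ B = bform Z (U $ A) (U $ B)"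
proof -
  have "(U ** Z ** transpose U) $ A $ B = (\<Sum>D\<in>UNIV. \<Sum>C\<in>UNIV. Z $ C $ D * U $ A $ C * U $ B $ D)"
    by (simp add: matrix_matrix_mult_def transpose_def sum_distrib_left sum_distrib_right mult_ac)
  also have "\<dots> = bform Z (U $ A) (U $ B)"
    unfolding bform_def by (rule sum.swap)
  finally show ?thesis .
qed

lemma bform_skew:
  assumes "\<forall>A B. Z $ A $ B = - (Z $ B $ A)"
  shows "bform Z p q = - bform Z q p"
proof -
  have "bform Z p q = (\<Sum>A\<in>UNIV. \<Sum>B\<in>UNIV. - (Z $ B $ A * q $ B * p $ A))"
    unfolding bform_def by (intro sum.cong refl) (subst assms[rule_format], simp)
  also have "\<dots> = - bform Z q p"
    unfolding bform_def by (subst sum.swap) (simp add: sum_negf)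
  finally show ?thesis .
qed

lemma bform_scale: "bform Z (c *s p) q = c * bform Z p q" "bform Z p (c *s q) = c * bform Z p q"
  by (simp_all add: bform_def sum_distrib_left mult_ac)

definition herm :: "complex ^ 4 \<Rightarrow> complex ^ 4 \<Rightarrow> complex" where
  "herm x y = (\<Sum>A\<in>UNIV. x $ A * cnj (y $ A))"

lemma Re_herm: "Re (herm x y) = x \<bullet> y"
  by (simp add: herm_def inner_vec_def inner_complex_def)

lemma Im_herm: "Im (herm x y) = x \<bullet> (\<i> *s y)"
  by (simp add: herm_def inner_vec_def inner_complex_def)

lemma herm_self: "herm x x = of_real ((norm x)\<^sup>2)"
proof (rule complex_eqI)
  show "Im (herm x x) = Im (of_real ((norm x)\<^sup>2))"
    by (simp add: herm_def)
qed (simp add: Re_herm dot_square_norm)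

lemma herm_sym: "herm y x = cnj (herm x y)"
  by (simp add: herm_def mult.commute)

lemma bform_herm: "bform Z r q = herm r (\<chi> A. cnj (\<Sum>B\<in>UNIV. Z $ A $ B * q $ B))"
  by (simp add: bform_def herm_def sum_distrib_left sum_distrib_right mult_ac)

text \<open>Complex orthogonality to \<open>y\<close> is real orthogonality to \<open>y\<close> and
  to \<open>\<i> *s y\<close>. Three vectors thus impose at most six real conditions on a space of
  real dimension eight.\<close>

lemma exists_unit_orthogonal:
  fixes ys :: "(complex ^ 4) list"
  assumes "length ys \<le> 3"
  obtains r where "norm r = 1" "\<forall>y \<in> set ys. herm r y = 0"
proof -
  define S where "S = set ys"
  have S: "finite S" "card S \<le> 3"
    using assms card_length[of ys] by (auto simp: S_def)
  let ?T = "S \<union> (\<lambda>y. \<i> *s y) ` S"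
  have "dim ?T \<le> card ?T"
    using S(1) by (intro dim_le_card') auto
  also have "\<dots> \<le> 2 * card S"
    using card_Un_le[of S "(\<lambda>y. \<i> *s y) ` S"] card_image_le[OF S(1), of "\<lambda>y. \<i> *s y"] by linarith
  also have "\<dots> < DIM(complex ^ 4)" using S(2) by simp
  finally obtain x where x: "x \<noteq> 0" "\<And>y. y \<in> span ?T \<Longrightarrow> orthogonal x y"
    using orthogonal_to_subspace_exists by blast
  have h: "herm x y = 0" if "y \<in> S" for y
    using x(2)[of y] x(2)[of "\<i> *s y"] that
    by (auto intro!: complex_eqI simp: Re_herm Im_herm orthogonal_def span_base)
  show ?thesis
  proof
    show "norm ((1 / norm x) *\<^sub>R x) = 1" using x by simp
    show "\<forall>y \<in> set ys. herm ((1 / norm x) *\<^sub>R x) y = 0"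
      using h unfolding S_def by (simp add: herm_def scaleR_sum_right[symmetric] del: scaleR_sum_right)
  qed
qed

text \<open>The equality case of Cauchy-Schwarz: taking \<open>r = g\<close> in the bound gives
  \<open>norm g \<le> \<sigma>\<close>, and the squared norm of
  \<open>g - \<sigma> *\<^sub>R p\<close> is that of \<open>g\<close> minus
  \<open>\<sigma>\<^sup>2\<close>.\<close>

lemma norm_attaining_vector:
  fixes g p :: "'a::real_inner"
  assumes le: "\<And>r. g \<bullet> r \<le> \<sigma> * norm r" and eq: "g \<bullet> p = \<sigma>" "norm p = 1"
  shows "g = \<sigma> *\<^sub>R p"
proof -
  have "norm g * norm g \<le> \<sigma> * norm g"
    using le[of g] by (simp add: dot_square_norm power2_eq_square)
  then have "norm g \<le> \<sigma>"
    using eq by (cases "g = 0") auto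
  then have "(norm g)\<^sup>2 \<le> \<sigma>\<^sup>2"
    by (simp add: power_mono)
  moreover have "(norm (g - \<sigma> *\<^sub>R p))\<^sup>2 = (norm g)\<^sup>2 - \<sigma>\<^sup>2"
  proof -
    have "p \<bullet> p = 1" using eq(2) by (simp add: dot_square_norm)
    then show ?thesis
      unfolding power2_norm_eq_inner using eq(1)
      by (simp add: inner_diff inner_commute[of p g] power2_eq_square)
  qed
  ultimately have "(norm (g - \<sigma> *\<^sub>R p))\<^sup>2 = 0"
    by (metis diff_le_0_iff_le zero_le_power2 order_antisym)
  then show ?thesis by simp
qed

lemma skew_eqI:
  fixes V W :: "complex ^ 4 ^ 4"
  assumes "\<forall>A B. V $ A $ B = - (V $ B $ A)" "\<forall>A B. W $ A $ B = - (W $ B $ A)"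
    and "V$1$2 = W$1$2" "V$1$3 = W$1$3" "V$1$4 = W$1$4" "V$2$3 = W$2$3" "V$2$4 = W$2$4" "V$3$4 = W$3$4"
  shows "V = W"
  unfolding vec_eq_iff forall_4 using skew_4[OF assms(1)] skew_4[OF assms(2)] assms(3-) by simp

lemma skew_diag_nth [simp]:
  "skew_diag z w $ 1 $ 1 = 0" "skew_diag z w $ 1 $ 2 = z" "skew_diag z w $ 1 $ 3 = 0" "skew_diag z w $ 1 $ 4 = 0"
  "skew_diag z w $ 2 $ 1 = - z" "skew_diag z w $ 2 $ 2 = 0" "skew_diag z w $ 2 $ 3 = 0" "skew_diag z w $ 2 $ 4 = 0"
  "skew_diag z w $ 3 $ 1 = 0" "skew_diag z w $ 3 $ 2 = 0" "skew_diag z w $ 3 $ 3 = 0" "skew_diag z w $ 3 $ 4 = w"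
  "skew_diag z w $ 4 $ 1 = 0" "skew_diag z w $ 4 $ 2 = 0" "skew_diag z w $ 4 $ 3 = - w" "skew_diag z w $ 4 $ 4 = 0"
  by (simp_all add: skew_diag_def)

lemma skew_diag_skew: "\<forall>A B. skew_diag z w $ A $ B = - (skew_diag z w $ B $ A)"
  unfolding forall_4 by simp

lemma pf_skew_diag [simp]: "pf (skew_diag z w) = z * w"
  by (simp add: pf_def)

lemma unitary_of_orthonormal_rows:
  assumes "norm p = 1" "norm q = 1" "norm r = 1" "norm s = 1"
    and "herm q p = 0" "herm r p = 0" "herm r q = 0" "herm s p = 0" "herm s q = 0" "herm s r = 0"
  shows "unitary_matrix (vector [p, q, r, s] :: complex ^ 4 ^ 4)"
proof -
  let ?U = "vector [p, q, r, s] :: complex ^ 4 ^ 4"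
  have "(?U ** adjoint_matrix ?U) $ A $ B = herm (?U $ A) (?U $ B)" for A B
    by (simp add: matrix_matrix_mult_def adjoint_matrix_def herm_def)
  moreover have "herm p q = 0" "herm p r = 0" "herm q r = 0" "herm p s = 0" "herm q s = 0" "herm r s = 0"
    using assms herm_sym by (metis complex_cnj_zero)+
  ultimately have "?U ** adjoint_matrix ?U = mat 1"
    unfolding vec_eq_iff forall_4 using assms by (simp add: mat_def herm_self)
  then show ?thesis
    unfolding unitary_matrix_def using matrix_left_right_inverse by blast
qed


text \<open>Compactness of the product of the unit spheres gives the maximiser, and homogeneity
  extends the bound to all vectors. Replacing \<open>p\<close> by its negative shows that the
  maximum is nonnegative.\<close>

lemma bform_attains_max:
  fixes Z :: "complex ^ 4 ^ 4"
  obtains p q \<sigma> where "norm p = 1" "norm q = 1" "Re (bform Z p q) = \<sigma>" "0 \<le> \<sigma>"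
    "\<And>r s. Re (bform Z r s) \<le> \<sigma> * norm r * norm s"
proof -
  let ?S = "sphere (0 :: complex ^ 4) 1 \<times> sphere (0 :: complex ^ 4) 1"
  have ax: "norm (axis 1 1 :: complex ^ 4) = 1" by (simp add: norm_axis_1)
  have "compact ?S" by (intro compact_Times compact_sphere)
  moreover have "?S \<noteq> {}"
    using ax by (metis SigmaI dist_0_norm empty_iff mem_sphere)
  moreover have "continuous_on ?S (\<lambda>x. Re (bform Z (fst x) (snd x)))"
    unfolding bform_def by (intro continuous_intros)
  ultimately obtain x where x: "x \<in> ?S" "\<forall>y\<in>?S. Re (bform Z (fst y) (snd y)) \<le> Re (bform Z (fst x) (snd x))"
    using continuous_attains_sup by meson
  define \<sigma> where "\<sigma> = Re (bform Z (fst x) (snd x))"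
  have le: "Re (bform Z r s) \<le> \<sigma>" if "norm r = 1" "norm s = 1" for r s
    using x(2) that unfolding \<sigma>_def by (metis SigmaI dist_0_norm fst_conv mem_sphere snd_conv)
  have x1: "norm (fst x) = 1" "norm (snd x) = 1" using x(1) by auto
  have "bform Z (- fst x) (snd x) = - bform Z (fst x) (snd x)"
    by (simp add: bform_def sum_negf)
  then have "0 \<le> \<sigma>" using le[of "- fst x" "snd x"] x1 by (simp add: \<sigma>_def)
  moreover have "Re (bform Z r s) \<le> \<sigma> * norm r * norm s" for r s
  proof (cases "r = 0 \<or> s = 0")
    case True
    then show ?thesis by (auto simp: bform_def)
  next
    case False
    have "bform Z ((1 / norm r) *\<^sub>R r) ((1 / norm s) *\<^sub>R s) = (1 / (norm r * norm s)) *\<^sub>R bform Z r s"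
      by (simp add: bform_def scaleR_sum_right mult.commute)
    moreover have "Re (bform Z ((1 / norm r) *\<^sub>R r) ((1 / norm s) *\<^sub>R s)) \<le> \<sigma>"
      using False by (intro le) simp_all
    ultimately show ?thesis
      using False by (simp add: field_simps)
  qed
  ultimately show ?thesis using that x1 \<sigma>_def by blast
qed

text \<open>The unitary normal form of a skew matrix: a maximiser \<open>(p, q)\<close> of \<open>Re (p\<^sup>T Z q)\<close> over unit vectors
  satisfies \<open>Z q = \<sigma> cnj p\<close> and \<open>Z p = - \<sigma> cnj q\<close>, so \<open>Z\<close> splits off the block of \<open>p, q\<close>.\<close>

lemma skew_normal_form:
  fixes Z :: "complex ^ 4 ^ 4"
  assumes skew: "\<forall>A B. Z $ A $ B = - (Z $ B $ A)"
  obtains U \<sigma> w where "unitary_matrix U" "U ** Z ** transpose U = skew_diag (of_real \<sigma>) w"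
    "cmod w \<le> \<sigma>" "\<And>p q. norm p = 1 \<Longrightarrow> norm q = 1 \<Longrightarrow> Re (bform Z p q) \<le> \<sigma>"
proof -
  obtain p q \<sigma> where pq: "norm p = 1" "norm q = 1" "Re (bform Z p q) = \<sigma>" and \<sigma>: "0 \<le> \<sigma>"
    and le: "\<And>r s. Re (bform Z r s) \<le> \<sigma> * norm r * norm s"
    using bform_attains_max[of Z] by metis
  \<comment> \<open>The gradient of \<open>Re (bform Z r q)\<close> with respect to
    \<open>r\<close>, for the real inner product; at a maximiser it must point along
    \<open>p\<close>.\<close>
  define g where "g = (\<lambda>q. \<chi> A. cnj (\<Sum>B\<in>UNIV. Z $ A $ B * q $ B))"
  have bg: "bform Z r q = herm r (g q)" for q r
    unfolding bform_herm g_def ..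
  have g: "g q \<bullet> r = Re (bform Z r q)" for q r
    unfolding bg Re_herm by (rule inner_commute)
  have "g q = \<sigma> *\<^sub>R p"
    by (rule norm_attaining_vector) (use le[of _ q] pq g in auto)
  then have bq: "bform Z r q = \<sigma> * herm r p" for r
    unfolding bg by (simp add: herm_def scaleR_conv_of_real[where 'a=complex] sum_distrib_left mult_ac)
  \<comment> \<open>By skewness \<open>- g p\<close> is the gradient in the second argument.\<close>
  have "- g p = \<sigma> *\<^sub>R q"
  proof (rule norm_attaining_vector)
    have "(- g p) \<bullet> r = Re (bform Z p r)" for r
      using g[of p r] bform_skew[OF skew, of r p] by simp
    then show "(- g p) \<bullet> r \<le> \<sigma> * norm r" "(- g p) \<bullet> q = \<sigma>" for r
      using le[of p] pq by auto
  qed (use pq in simp)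
  then have "g p = - (\<sigma> *\<^sub>R q)" by (metis minus_minus)
  then have bp: "bform Z r p = - \<sigma> * herm r q" for r
    unfolding bg by (simp add: herm_def scaleR_conv_of_real[where 'a=complex] sum_distrib_left sum_negf mult_ac)
  \<comment> \<open>Orthogonality of \<open>p\<close> and \<open>q\<close> comes from dividing
    \<open>bform Z p p = 0\<close> by \<open>\<sigma>\<close>; if \<open>\<sigma> = 0\<close>, the
    whole matrix vanishes.\<close>
  show ?thesis
  proof (cases "\<sigma> = 0")
    case True
    have g0: "g s = 0" for s
      using le[of "g s" s] g[of s "g s"] True inner_gt_zero_iff[of "g s"] by force
    then have "Z $ A $ B = 0" for A B
    proof -
      have "g (axis B 1) $ A = 0" unfolding g0 by simp
      then show ?thesis
        by (simp add: g_def axis_def if_distrib[of "(*) a" for a] if_distrib[of cnj] cong: if_cong)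
    qed
    then have "mat 1 ** Z ** transpose (mat 1) = skew_diag (of_real \<sigma>) 0"
      unfolding vec_eq_iff forall_4 congruence_eq_bform by (simp add: bform_def True)
    then show ?thesis
      using that[of "mat 1" \<sigma> 0] True le by (metis mult_zero_left norm_zero order_refl unitary_mat_1)
  next
    case False
    have "bform Z p p = 0"
      using bform_skew[OF skew, of p p] by simp
    then have pq0: "herm p q = 0" using bp[of p] False by simp
    have qp0: "herm q p = 0" using pq0 herm_sym[of q p] by simp
    obtain r where r: "norm r = 1" "herm r p = 0" "herm r q = 0"
      using exists_unit_orthogonal[of "[p, q]"] by auto
    obtain s where s: "norm s = 1" "herm s p = 0" "herm s q = 0" "herm s r = 0"
      using exists_unit_orthogonal[of "[p, q, r]"] by auto
    define U :: "complex ^ 4 ^ 4" where "U = vector [p, q, r, s]"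
    have U: "unitary_matrix U"
      unfolding U_def using pq r s qp0 by (intro unitary_of_orthonormal_rows) auto
    have "U ** Z ** transpose U = skew_diag (of_real \<sigma>) (bform Z r s)"
    proof (rule skew_eqI[OF congruence_skew_skew[OF skew] skew_diag_skew]; unfold congruence_eq_bform)
      show "bform Z (U $ 1) (U $ 2) = skew_diag (of_real \<sigma>) (bform Z r s) $ 1 $ 2"
        using pq(1) by (simp add: U_def bq herm_self)
    qed (use r s bform_skew[OF skew, of p] bform_skew[OF skew, of q] in \<open>simp_all add: U_def bq bp\<close>)
    moreover have "cmod (bform Z r s) \<le> \<sigma>"
    proof -
      \<comment> \<open>This phase makes the form real and nonnegative, so the bound on real parts
        becomes a bound on the modulus. Since \<open>sgn 0 = 0\<close>, only
        \<open>cmod c \<le> 1\<close> holds in general.\<close>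
      define c where "c = cnj (sgn (bform Z r s))"
      have "bform Z (c *s r) s = of_real (cmod (bform Z r s))"
        unfolding bform_scale
        by (cases "bform Z r s = 0")
           (simp_all add: c_def sgn_eq complex_norm_square[symmetric] power2_eq_square mult.commute)
      then have "cmod (bform Z r s) \<le> \<sigma> * norm (c *s r)"
        using le[of "c *s r" s] s by simp
      also have "norm (c *s r) \<le> 1"
      proof -
        have "herm (c *s r) (c *s r) = c * cnj c * herm r r"
          by (simp add: herm_def sum_distrib_left mult_ac)
        then have "(norm (c *s r))\<^sup>2 = (cmod c)\<^sup>2"
          using r(1) by (simp add: herm_self complex_norm_square[symmetric] del: of_real_power)
        moreover have "cmod c \<le> 1" by (simp add: c_def norm_sgn)
        ultimately show ?thesis by (simp add: abs_le_square_iff[symmetric])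
      qed
      then have "\<sigma> * norm (c *s r) \<le> \<sigma>" using \<sigma> by (simp add: mult_left_le)
      finally show ?thesis .
    qed
    moreover have "Re (bform Z p q) \<le> \<sigma>" if "norm p = 1" "norm q = 1" for p q
      using le[of p q] that by simp
    ultimately show ?thesis using that U by blast
  qed
qed

section \<open>Skew-eigenvalues and the BPS mass\<close>

lemma det_adjoint: "det (adjoint_matrix (U :: complex ^ 4 ^ 4)) = cnj (det U)"
  unfolding det_4 adjoint_matrix_def by (simp add: algebra_simps)

lemma unitary_cmod_det:
  assumes "unitary_matrix (U :: complex ^ 4 ^ 4)"
  shows "cmod (det U) = 1"
proof -
  have "det U * cnj (det U) = 1"
    using assms by (metis det_I det_adjoint det_mul unitary_matrix_def)
  then have "(cmod (det U))\<^sup>2 = 1"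
    by (metis complex_norm_square of_real_eq_1_iff)
  then show ?thesis
    using norm_ge_zero[of "det U"] by (auto simp: power2_eq_1_iff)
qed

text \<open>Neither right-hand side mentions \<open>U\<close>, and together they fix sum and product
  of the squared moduli. So these moduli do not depend on the diagonalising matrix.\<close>

lemma unitary_skew_diag_invariants:
  fixes Z :: "complex ^ 4 ^ 4"
  assumes skew: "\<forall>A B. Z $ A $ B = - (Z $ B $ A)"
    and U: "unitary_matrix U" "U ** Z ** transpose U = skew_diag z w"
  shows "2 * ((cmod z)\<^sup>2 + (cmod w)\<^sup>2) = (\<Sum>A\<in>UNIV. \<Sum>B\<in>UNIV. (cmod (Z $ A $ B))\<^sup>2)"
    "cmod z * cmod w = cmod (pf Z)"
proof -
  show "2 * ((cmod z)\<^sup>2 + (cmod w)\<^sup>2) = (\<Sum>A\<in>UNIV. \<Sum>B\<in>UNIV. (cmod (Z $ A $ B))\<^sup>2)"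
    unfolding unitary_congruence_cmod_sum[OF U(1), of Z, symmetric] U(2) by (simp add: sum_4)
  have "z * w = det U * pf Z"
    using pf_congruence[OF skew, of U] U(2) by simp
  then show "cmod z * cmod w = cmod (pf Z)"
    using unitary_cmod_det[OF U(1)] by (metis mult_1 norm_mult)
qed

text \<open>The phases of skew-eigenvalues vary with the diagonalising matrix, so the set of
  skew-eigenvalues is in general infinite; \<open>Max\<close> makes sense because at most two moduli
  occur.\<close>

lemma BPS_mass_eq:
  assumes Z: "Z \<in> charge_space" and U: "unitary_matrix U"
    and eq: "U ** fst Z ** transpose U = skew_diag (of_real \<sigma>) w" and le: "cmod w \<le> \<sigma>"
  shows "BPS_mass Z = \<sigma>"
proof -
  note skew = Z[unfolded charge_space_iff]
  have \<sigma>: "0 \<le> \<sigma>" using le norm_ge_zero order_trans by blast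
  have sub: "cmod ` skew_eigenvalues (fst Z) \<subseteq> {\<sigma>, cmod w}"
  proof
    fix t assume "t \<in> cmod ` skew_eigenvalues (fst Z)"
    then obtain z' w' V where t: "t = cmod z'" and V: "unitary_matrix V" "V ** fst Z ** transpose V = skew_diag z' w'"
      unfolding skew_eigenvalues_def by auto
    note inv = unitary_skew_diag_invariants[OF skew U eq] unitary_skew_diag_invariants[OF skew V]
    have 1: "(cmod z')\<^sup>2 + (cmod w')\<^sup>2 = \<sigma>\<^sup>2 + (cmod w)\<^sup>2" "cmod z' * cmod w' = \<sigma> * cmod w"
      using inv \<sigma> by auto
    \<comment> \<open>Equal sum and product: \<open>t\<^sup>2\<close> is a root of the quadratic
      with roots \<open>\<sigma>\<^sup>2\<close> and \<open>(cmod w)\<^sup>2\<close>.\<close>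
    have "(t\<^sup>2 - \<sigma>\<^sup>2) * (t\<^sup>2 - (cmod w)\<^sup>2) = 0"
      using 1 unfolding t by algebra
    then have "t = \<sigma> \<or> t = cmod w"
      using \<sigma> t by (auto simp: power2_eq_iff_nonneg)
    then show "t \<in> {\<sigma>, cmod w}" by auto
  qed
  have mem: "\<sigma> \<in> cmod ` skew_eigenvalues (fst Z)"
    using U eq \<sigma> unfolding skew_eigenvalues_def by (intro image_eqI[of _ _ "of_real \<sigma>"]) auto
  show ?thesis
    unfolding BPS_mass_def
  proof (rule Max_eqI)
    show "finite (cmod ` skew_eigenvalues (fst Z))" using sub by (rule finite_subset) simp
    show "t \<le> \<sigma>" if "t \<in> cmod ` skew_eigenvalues (fst Z)" for t
      using sub that le by auto
  qed (rule mem)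
qed

section \<open>Attractor points\<close>

definition cnjm :: "complex ^ 'm ^ 'k \<Rightarrow> complex ^ 'm ^ 'k" where
  "cnjm W = (\<chi> A B. cnj (W $ A $ B))"

lemma cnjm_nth: "cnjm W $ A $ B = cnj (W $ A $ B)"
  by (simp add: cnjm_def)

text \<open>The complex-linear Hodge star on two-forms; composed with \<open>cnjm\<close> it becomes
  an antilinear involution of the skew matrices.\<close>

definition sdual :: "complex ^ 4 ^ 4 \<Rightarrow> complex ^ 4 ^ 4" where
  "sdual W = (\<chi> A B. 1/2 * (\<Sum>C\<in>UNIV. \<Sum>D\<in>UNIV. eps A B C D * W $ C $ D))"

text \<open>The fixed points of \<open>sdual (cnjm T)\<close>, that is, the reality condition of
  \<open>coset_params\<close> for a single matter index.\<close>

definition self_dual :: "complex ^ 4 ^ 4 \<Rightarrow> bool" where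
  "self_dual T \<longleftrightarrow> (\<forall>A B. T $ A $ B = - (T $ B $ A)) \<and>
     T$3$4 = cnj (T$1$2) \<and> T$2$4 = - cnj (T$1$3) \<and> T$2$3 = cnj (T$1$4)"

lemma sdual_nth:
  assumes "\<forall>A B. W $ A $ B = - (W $ B $ A)"
  shows "sdual W $1$2 = W$3$4" "sdual W $1$3 = - W$2$4" "sdual W $1$4 = W$2$3"
    "sdual W $2$3 = W$1$4" "sdual W $2$4 = - W$1$3" "sdual W $3$4 = W$1$2"
  unfolding sdual_def vec_lambda_beta eps_sum using skew_4[OF assms] by simp_all

lemma sdual_skew: "\<forall>A B. sdual W $ A $ B = - (sdual W $ B $ A)"
  unfolding sdual_def vec_lambda_beta eps_sum forall_4 by (simp add: field_simps)

lemma cnjm_skew: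
  assumes "\<forall>A B. W $ A $ B = - (W $ B $ A)"
  shows "\<forall>A B. cnjm W $ A $ B = - (cnjm W $ B $ A)"
  unfolding cnjm_def vec_lambda_beta complex_cnj_minus[symmetric] using assms by metis

text \<open>Symmetrising over the involution turns any skew matrix into an admissible
  direction.\<close>

lemma self_dual_add_sdual:
  assumes skew: "\<forall>A B. V $ A $ B = - (V $ B $ A)"
  shows "self_dual (V + sdual (cnjm V))"
proof -
  have "(V + sdual (cnjm V)) $ A $ B = - ((V + sdual (cnjm V)) $ B $ A)" for A B
    unfolding vector_add_component minus_add_distrib
    by (intro arg_cong2[of _ _ _ _ "(+)"] skew[rule_format] sdual_skew[rule_format])
  moreover have "(V + sdual (cnjm V))$3$4 = cnj ((V + sdual (cnjm V))$1$2)"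
    "(V + sdual (cnjm V))$2$4 = - cnj ((V + sdual (cnjm V))$1$3)"
    "(V + sdual (cnjm V))$2$3 = cnj ((V + sdual (cnjm V))$1$4)"
    by (simp_all add: sdual_nth[OF cnjm_skew[OF skew]] cnjm_nth)
  ultimately show ?thesis
    unfolding self_dual_def by blast
qed

text \<open>Rank-one parameters with real \<open>v\<close> are the only \<open>O(6,n)\<close>
  directions used, for the boosts as well as at the attractor point.\<close>

lemma self_dual_coset_params:
  fixes v :: "real ^ ('n::finite)"
  assumes T: "self_dual T"
  shows "(0, \<chi> A B I. T $ A $ B * of_real (v $ I)) \<in> coset_params"
proof -
  have skew: "\<forall>A B. T $ A $ B = - (T $ B $ A)"
    using T unfolding self_dual_def by blast
  have T': "T$3$4 = cnj (T$1$2)" "T$2$4 = - cnj (T$1$3)" "T$2$3 = cnj (T$1$4)"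
    using T unfolding self_dual_def by blast+
  have 1: "cnj (T $ A $ B) = 1/2 * (\<Sum>C\<in>UNIV. \<Sum>D\<in>UNIV. eps A B C D * T $ C $ D)" for A B
    unfolding eps_sum using T' skew_4[OF skew] exhaust_4[of A] exhaust_4[of B]
    by (elim disjE) simp_all
  have 2: "(\<Sum>J\<in>UNIV. \<Sum>C\<in>UNIV. \<Sum>D\<in>UNIV. eta I J * eps A B C D * (T $ C $ D * of_real (v $ J)))
     = (\<Sum>C\<in>UNIV. \<Sum>D\<in>UNIV. eps A B C D * T $ C $ D) * of_real (v $ I)" for A B I
  proof -
    have "(\<Sum>J\<in>UNIV. \<Sum>C\<in>UNIV. \<Sum>D\<in>UNIV. eta I J * eps A B C D * (T $ C $ D * of_real (v $ J)))
      = (\<Sum>J\<in>UNIV. if I = J then (\<Sum>C\<in>UNIV. \<Sum>D\<in>UNIV. eps A B C D * T $ C $ D) * of_real (v $ J) else 0)"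
      by (intro sum.cong refl) (simp add: eta_def sum_distrib_right mult.assoc)
    then show ?thesis by simp
  qed
  show ?thesis
    unfolding coset_params_iff vec_lambda_beta 2
  proof (intro conjI allI)
    fix A B I
    show "T $ A $ B * of_real (v $ I) = - (T $ B $ A * of_real (v $ I))"
      by (subst skew[rule_format]) simp
    show "cnj (T $ A $ B * of_real (v $ I)) =
       1/2 * ((\<Sum>C\<in>UNIV. \<Sum>D\<in>UNIV. eps A B C D * T $ C $ D) * of_real (v $ I))"
      by (simp add: 1)
  qed
qed

lemma coset_var_rank_one:
  fixes v :: "real ^ ('n::finite)"
  shows "coset_var (0, \<chi> A B I. T $ A $ B * of_real (v $ I)) Z =
    (\<chi> A B. T $ A $ B * (\<Sum>I\<in>UNIV. of_real (v $ I) * cnj (snd Z $ I)),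
     \<chi> I. of_real (v $ I) * (1/2 * (\<Sum>A\<in>UNIV. \<Sum>B\<in>UNIV. T $ A $ B * cnj (fst Z $ A $ B))))"
  by (simp add: coset_var_def sum_distrib_left mult_ac)

lemma coset_var_xi: "fst (coset_var (\<xi>, 0) Z) $ A $ B = \<xi> * sdual (cnjm (fst Z)) $ A $ B"
  by (simp add: coset_var_def sdual_def cnjm_def)

text \<open>The (1,2) entry of the identity
  \<open>U (sdual (U^T W U)) U^T = det U (sdual W)\<close>, the covariance of the Hodge
  star.\<close>

lemma sdual_congruence_12:
  fixes U W :: "complex ^ 4 ^ 4"
  assumes skew: "\<forall>A B. W $ A $ B = - (W $ B $ A)"
  shows "(U ** sdual (transpose U ** W ** U) ** transpose U) $ 1 $ 2 = det U * W $ 3 $ 4"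
proof -
  note c = congruence_skew[OF skew, of "transpose U", unfolded transpose_transpose]
  note sk = congruence_skew_skew[OF skew, of "transpose U", unfolded transpose_transpose]
  show ?thesis
    unfolding congruence_skew[OF sdual_skew] sdual_nth[OF sk] c det_4
    unfolding transpose_def vec_lambda_beta by algebra
qed

lemma cnjm_mult: "cnjm (A ** B) = cnjm A ** cnjm B"
  by (simp add: cnjm_def matrix_matrix_mult_def)

lemma cnjm_transpose: "cnjm (transpose U) = transpose (cnjm U)"
  by (simp add: cnjm_def transpose_def)

lemma adjoint_eq: "adjoint_matrix U = transpose (cnjm U)"
  by (simp add: adjoint_matrix_def cnjm_def transpose_def)

lemma cnjm_cnjm [simp]: "cnjm (cnjm U) = U"
  by (simp add: cnjm_def vec_eq_iff)

lemma unitary_cnjm: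
  assumes "unitary_matrix U"
  shows "transpose U ** cnjm U = mat 1" "transpose (cnjm U) ** U = mat 1"
proof -
  show 1: "transpose (cnjm U) ** U = mat 1"
    using assms by (simp add: unitary_matrix_def adjoint_eq)
  have "cnjm (transpose (cnjm U) ** U) = cnjm (mat 1)" by (simp only: 1)
  then show "transpose U ** cnjm U = mat 1"
    by (simp add: cnjm_mult cnjm_transpose) (simp add: cnjm_def mat_def if_distrib[of cnj] cong: if_cong)
qed

text \<open>For unitary \<open>U\<close> the antilinear involution commutes with congruence up to
  \<open>det U\<close>. Through it the second skew-eigenvalue enters the variation of the (1,2)
  entry.\<close>

lemma unitary_sdual_cnjm_12:
  fixes U V :: "complex ^ 4 ^ 4"
  assumes skew: "\<forall>A B. V $ A $ B = - (V $ B $ A)" and U: "unitary_matrix U"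
  shows "(U ** sdual (cnjm V) ** transpose U) $ 1 $ 2 = det U * cnj ((U ** V ** transpose U) $ 3 $ 4)"
proof -
  let ?D = "U ** V ** transpose U"
  have "transpose U ** cnjm ?D ** U = (transpose U ** cnjm U) ** cnjm V ** (transpose (cnjm U) ** U)"
    by (simp add: cnjm_mult cnjm_transpose matrix_mul_assoc)
  also have "\<dots> = cnjm V"
    by (simp add: unitary_cnjm[OF U])
  finally show ?thesis
    using sdual_congruence_12[OF cnjm_skew[OF congruence_skew_skew[OF skew, of U]], of U]
    by (simp add: cnjm_def)
qed

lemma unitary_row_norm:
  assumes "unitary_matrix (U :: complex ^ 4 ^ 4)"
  shows "norm (U $ A) = 1"
proof -
  have "(U ** adjoint_matrix U) $ A $ A = 1"
    using assms by (simp add: unitary_matrix_def mat_def)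
  moreover have "(U ** adjoint_matrix U) $ A $ A = herm (U $ A) (U $ A)"
    by (simp add: matrix_matrix_mult_def adjoint_matrix_def herm_def)
  ultimately have "(norm (U $ A))\<^sup>2 = 1"
    unfolding herm_self by (metis of_real_eq_1_iff)
  then show ?thesis
    using norm_ge_zero[of "U $ A"] by (auto simp: power2_eq_1_iff)
qed

section \<open>Stationarity of the BPS mass\<close>

lemma bform_le_BPS_mass:
  assumes Z: "Z \<in> charge_space" and "norm p = 1" "norm q = 1"
  shows "Re (bform (fst Z) p q) \<le> BPS_mass Z"
proof -
  obtain U \<sigma> w where "unitary_matrix U" "U ** fst Z ** transpose U = skew_diag (of_real \<sigma>) w"
    "cmod w \<le> \<sigma>" "\<And>p q. norm p = 1 \<Longrightarrow> norm q = 1 \<Longrightarrow> Re (bform (fst Z) p q) \<le> \<sigma>"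
    using skew_normal_form[OF Z[unfolded charge_space_iff]] by metis
  then show ?thesis using BPS_mass_eq[OF Z] assms by metis
qed

lemma bform_transpose: "bform (transpose W) p q = bform W q p"
  unfolding bform_def transpose_def by (subst sum.swap) (simp add: mult_ac)

lemma bform_linear:
  "bform (V + W) p q = bform V p q + bform W p q"
  "bform (- W) p q = - bform W p q"
  "bform (\<chi> A B. c * W $ A $ B) p q = c * bform W p q"
  "bform (r *\<^sub>R W) p q = r *\<^sub>R bform W p q"
  by (simp_all add: bform_def sum.distrib sum_negf sum_distrib_left scaleR_sum_right algebra_simps)

text \<open>The isotropy rotations preserve the skew-eigenvalues, so to first order they
  only change the phase of \<open>p\<^sup>T Z q\<close>.\<close>

lemma isotropy_var_stationary:
  assumes Z: "Z \<in> charge_space" and U: "unitary_matrix U"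
    and D: "U ** fst Z ** transpose U = skew_diag (of_real \<sigma>) w"
    and alg: "\<omega> \<in> isotropy_algebra"
  shows "Re (bform (fst (isotropy_var \<omega> Z)) (U $ 1) (U $ 2)) = 0"
proof -
  obtain h r \<theta> where \<omega>: "\<omega> = (h, r, \<theta>)" by (cases \<omega>) auto
  have h: "adjoint_matrix h = - h" using alg by (simp add: isotropy_algebra_def \<omega>)
  have split: "fst (isotropy_var \<omega> Z) = h ** fst Z + fst Z ** transpose h + (\<chi> A B. (\<i> * of_real \<theta>) * fst Z $ A $ B)"
    by (simp add: isotropy_var_def \<omega> vec_eq_iff)
  \<comment> \<open>The rotation \<open>h\<close> in the basis where \<open>Z\<close> has normal
    form. It is anti-Hermitian, so its diagonal, which alone enters the (1,2) entry, is imaginary;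
    the \<open>\<theta>\<close>-term is imaginary as well.\<close>
  define V where "V = U ** h ** adjoint_matrix U"
  have "adjoint_matrix V = U ** adjoint_matrix h ** adjoint_matrix U"
    by (simp add: V_def adjoint_eq cnjm_mult cnjm_transpose matrix_transpose_mul matrix_mul_assoc)
  also have "\<dots> = - V"
    by (simp add: h V_def matrix_matrix_mult_def vec_eq_iff sum_negf)
  finally have anti: "adjoint_matrix V = - V" .
  have V: "Re (V $ A $ A) = 0" for A
  proof -
    have "cnj (V $ A $ A) = - (V $ A $ A)"
      using anti by (simp add: adjoint_matrix_def vec_eq_iff)
    then show ?thesis by (simp add: complex_eq_iff)
  qed
  have "U ** (h ** fst Z) ** transpose U = U ** h ** (adjoint_matrix U ** U) ** fst Z ** transpose U"
    using U by (simp add: unitary_matrix_def matrix_mul_assoc)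
  also have "\<dots> = V ** skew_diag (of_real \<sigma>) w"
    unfolding D[symmetric] V_def by (simp add: matrix_mul_assoc)
  finally have hZ: "bform (h ** fst Z) (U $ A) (U $ B) = (V ** skew_diag (of_real \<sigma>) w) $ A $ B" for A B
    unfolding congruence_eq_bform[symmetric] by simp
  have "transpose (fst Z) = - fst Z" using Z by (simp add: charge_space_def)
  then have "transpose (h ** fst Z) = (- fst Z) ** transpose h"
    by (simp only: matrix_transpose_mul)
  then have "fst Z ** transpose h = transpose (- (h ** fst Z))"
    by (simp add: matrix_matrix_mult_def transpose_def vec_eq_iff sum_negf)
  then have Zh: "bform (fst Z ** transpose h) p q = - bform (h ** fst Z) q p" for p q
    by (simp only: bform_transpose bform_linear)
  have "bform (fst Z) (U $ 1) (U $ 2) = of_real \<sigma>"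
    unfolding congruence_eq_bform[symmetric] D by simp
  then show ?thesis
    unfolding split bform_linear Zh hZ using V by (simp add: matrix_matrix_mult_def sum_4)
qed

lemma attractor_coset_directions:
  fixes L :: "'m::euclidean_space \<Rightarrow> ('n::finite) charges \<Rightarrow> 'n charges"
  assumes chart: "moduli_chart X L \<omega> P" and Q: "Q \<in> charge_space" and attr: "attractor_point X L Q \<phi>"
    and U: "unitary_matrix U"
    and D: "U ** fst (L \<phi> Q) ** transpose U = skew_diag (of_real \<sigma>) w" "cmod w \<le> \<sigma>"
    and \<pi>: "\<pi> \<in> coset_params"
  shows "Re (bform (fst (coset_var \<pi> (L \<phi> Q))) (U $ 1) (U $ 2)) = 0"
proof -
  have X: "open X" and \<phi>: "\<phi> \<in> X"
    and dmass: "((\<lambda>\<psi>. BPS_mass (L \<psi> Q)) has_derivative (\<lambda>_. 0)) (at \<phi>)"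
    using chart attr by (auto simp: moduli_chart_def attractor_point_def)
  have LX: "L \<psi> Q \<in> charge_space" if "\<psi> \<in> X" for \<psi>
    using chart that U_duality_invariants(1)[OF _ Q] by (simp add: moduli_chart_def)
  \<comment> \<open>\<open>U\<close> is frozen at \<open>\<phi>\<close>, so \<open>b\<close> is
    linear in the charges; \<open>BPS_mass - b\<close> is nonnegative on \<open>X\<close> and zero
    at \<open>\<phi>\<close>, hence minimal there.\<close>
  define b where "b = (\<lambda>Z :: 'n charges. Re (bform (fst Z) (U $ 1) (U $ 2)))"
  have "linear b"
    by (rule linearI) (simp_all add: b_def bform_linear)
  then have b: "bounded_linear b" by (simp add: linear_conv_bounded_linear)
  \<comment> \<open>Surjectivity of the vielbein realises every coset direction by a displacement of
    the moduli.\<close>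
  obtain v where v: "P \<phi> v = \<pi>"
    using chart \<phi> \<pi> unfolding moduli_chart_def bij_betw_def by (metis imageE)
  let ?d = "\<lambda>v. isotropy_var (\<omega> \<phi> v) (L \<phi> Q) + coset_var (P \<phi> v) (L \<phi> Q)"
  have "((\<lambda>\<psi>. L \<psi> Q) has_derivative ?d) (at \<phi>)"
    using chart \<phi> Q by (simp add: moduli_chart_def)
  from has_derivative_diff[OF dmass bounded_linear.has_derivative[OF b this]]
  have "((\<lambda>\<psi>. BPS_mass (L \<psi> Q) - b (L \<psi> Q)) has_derivative (\<lambda>v. 0 - b (?d v))) (at \<phi>)" .
  moreover have "BPS_mass (L \<phi> Q) = b (L \<phi> Q)"
    using BPS_mass_eq[OF LX[OF \<phi>] U D] D(1) unfolding b_def congruence_eq_bform[symmetric] by simp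
  then have "\<forall>\<psi>\<in>X. BPS_mass (L \<phi> Q) - b (L \<phi> Q) \<le> BPS_mass (L \<psi> Q) - b (L \<psi> Q)"
    using bform_le_BPS_mass[OF LX] unitary_row_norm[OF U] by (simp add: b_def)
  ultimately have "(\<lambda>v. 0 - b (?d v)) = (\<lambda>v. 0)"
    using differential_zero_maxmin[OF \<phi> X] by blast
  from fun_cong[OF this, of v] have "b (?d v) = 0" by simp
  moreover have "b (isotropy_var (\<omega> \<phi> v) (L \<phi> Q)) = 0"
  proof -
    have "range (\<omega> \<phi>) \<subseteq> isotropy_algebra" using chart \<phi> by (simp add: moduli_chart_def)
    then show ?thesis
      unfolding b_def by (intro isotropy_var_stationary[OF LX[OF \<phi>] U D(1)]) auto
  qed
  ultimately show ?thesis
    by (simp add: linear_add[OF \<open>linear b\<close>] v) (simp add: b_def)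
qed

lemma attractor:
  fixes L :: "'m::euclidean_space \<Rightarrow> ('n::finite) charges \<Rightarrow> 'n charges"
  assumes chart: "moduli_chart X L \<omega> P" and Q: "Q \<in> charge_space" and attr: "attractor_point X L Q \<phi>"
  shows "snd (L \<phi> Q) = 0" "eps_ZZ (L \<phi> Q) = 0" "S_inv (L \<phi> Q) = of_real ((BPS_mass (L \<phi> Q))\<^sup>2)"
proof -
  define Z where "Z = L \<phi> Q"
  have Z: "Z \<in> charge_space"
    using chart attr U_duality_invariants(1)[OF _ Q] by (simp add: Z_def moduli_chart_def attractor_point_def)
  note skew = Z[unfolded charge_space_iff]
  obtain U \<sigma> w where U: "unitary_matrix U" and D: "U ** fst Z ** transpose U = skew_diag (of_real \<sigma>) w"
    and w: "cmod w \<le> \<sigma>"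
    using skew_normal_form[OF skew] by metis
  note dir = attractor_coset_directions[OF chart Q attr U D[unfolded Z_def] w, folded Z_def]
  have w0: "w = 0"
  proof -
    \<comment> \<open>Chosen so that the stationarity condition reads
      \<open>(cmod w)\<^sup>2 = 0\<close>; the factor \<open>cnj (det U)\<close> removes the phase
      of the determinant.\<close>
    define \<xi> where "\<xi> = cnj (det U) * w"
    have "fst (coset_var (\<xi>, 0) Z) = (\<chi> A B. \<xi> * sdual (cnjm (fst Z)) $ A $ B)"
      by (simp add: vec_eq_iff coset_var_xi)
    moreover have "bform (sdual (cnjm (fst Z))) (U $ 1) (U $ 2) = det U * cnj w"
      unfolding congruence_eq_bform[symmetric] unitary_sdual_cnjm_12[OF skew U] D by simp
    ultimately have "Re (\<xi> * (det U * cnj w)) = 0"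
      using dir[OF zero_Xi_in_coset_params, of \<xi>] by (simp only: bform_linear)
    moreover have "\<xi> * (det U * cnj w) = of_real ((cmod (det U))\<^sup>2 * (cmod w)\<^sup>2)"
      unfolding of_real_mult complex_norm_square by (simp add: \<xi>_def)
    ultimately show ?thesis by (simp add: unitary_cmod_det[OF U])
  qed
  have "snd Z $ I = 0" for I
  proof -
    \<comment> \<open>After congruence by \<open>U\<close>, \<open>V\<close> has (1,2) entry
      \<open>snd Z $ I\<close> and (3,4) entry zero, so the dual added to make \<open>T\<close>
      self-dual does not change the (1,2) entry. Along \<open>T\<close> and the axis
      \<open>I\<close> the variation is then the squared modulus of the matter charge.\<close>
    define E where "E = skew_diag (snd Z $ I) 0"
    define V where "V = adjoint_matrix U ** E ** transpose (adjoint_matrix U)"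
    have V: "\<forall>A B. V $ A $ B = - (V $ B $ A)"
      unfolding V_def E_def by (rule congruence_skew_skew[OF skew_diag_skew])
    have 1: "U ** adjoint_matrix U = mat 1" using U by (simp add: unitary_matrix_def)
    then have "transpose (U ** adjoint_matrix U) = mat 1" by (simp add: transpose_mat)
    then have 2: "transpose (adjoint_matrix U) ** transpose U = mat 1" by (simp add: matrix_transpose_mul)
    have "U ** V ** transpose U = (U ** adjoint_matrix U) ** E ** (transpose (adjoint_matrix U) ** transpose U)"
      by (simp add: V_def matrix_mul_assoc)
    then have UV: "U ** V ** transpose U = E" by (simp add: 1 2)
    define T where "T = V + sdual (cnjm V)"
    have T: "bform T (U $ 1) (U $ 2) = snd Z $ I"
      unfolding T_def bform_linear
      unfolding congruence_eq_bform[symmetric] unitary_sdual_cnjm_12[OF V U] UV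
      by (simp add: E_def)
    define \<Xi> where "\<Xi> = (\<chi> A B J. T $ A $ B * of_real ((axis I 1 :: real ^ 'n) $ J))"
    have "fst (coset_var (0, \<Xi>) Z) = (\<chi> A B. cnj (snd Z $ I) * T $ A $ B)"
      unfolding \<Xi>_def coset_var_rank_one
      by (simp add: axis_def if_distrib[of of_real] if_distrib[of "(*) a" for a]
          if_distrib[of "\<lambda>x. x * _"] mult.commute cong: if_cong)
    moreover have "(0, \<Xi>) \<in> coset_params"
      unfolding \<Xi>_def T_def by (rule self_dual_coset_params[OF self_dual_add_sdual[OF V]])
    ultimately have "Re (cnj (snd Z $ I) * snd Z $ I) = 0"
      using dir[of "(0, \<Xi>)"] by (simp only: bform_linear T)
    then show ?thesis by (simp add: complex_eq_iff)
  qed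
  then have s0: "snd Z = 0" by (simp add: vec_eq_iff)
  have e0: "eps_ZZ Z = 0"
  proof -
    have "cmod (pf (fst Z)) = 0"
      using unitary_skew_diag_invariants(2)[OF skew U D] w0 by simp
    then show ?thesis by (simp add: eps_ZZ_coords[OF Z])
  qed
  have "I1 Z = \<sigma>\<^sup>2"
    using unitary_skew_diag_invariants(1)[OF skew U D] w0 by (simp add: I1_def s0)
  moreover have "I2 Z = 0" by (simp add: I2_def s0 e0)
  moreover have "csqrt (of_real ((\<sigma>\<^sup>2)\<^sup>2)) = of_real (\<sigma>\<^sup>2)"
    using real_sqrt_abs[of "\<sigma>\<^sup>2"] by (subst csqrt_of_real_nonneg) (auto simp del: of_real_power)
  ultimately have "S_inv Z = of_real ((BPS_mass Z)\<^sup>2)"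
    by (simp add: S_inv_def BPS_mass_eq[OF Z U D w] del: of_real_power)
  with s0 e0 show "snd (L \<phi> Q) = 0" "eps_ZZ (L \<phi> Q) = 0" "S_inv (L \<phi> Q) = of_real ((BPS_mass (L \<phi> Q))\<^sup>2)"
    by (simp_all add: Z_def)
qed

section \<open>Orbits of \<open>O(6,n)\<close>\<close>

lemma coset_var_linear: "linear (coset_var p)"
proof -
  obtain \<xi> \<Xi> where p: "p = (\<xi>, \<Xi>)" by fastforce
  show ?thesis
    by (rule linearI)
       (simp_all add: p coset_var_def vec_eq_iff prod_eq_iff sum.distrib sum_distrib_left
         scaleR_conv_of_real[where 'a=complex] algebra_simps)
qed

lemma coset_var_scaleR: "coset_var (s *\<^sub>R p) Z = s *\<^sub>R coset_var p Z"
proof -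
  obtain \<xi> \<Xi> where p: "p = (\<xi>, \<Xi>)" by fastforce
  show ?thesis
    by (simp add: p coset_var_def vec_eq_iff prod_eq_iff sum_distrib_left
        scaleR_conv_of_real[where 'a=complex] algebra_simps)
qed

text \<open>If the generator satisfies \<open>K\<^sup>3 = K\<close> then \<open>exp (s K) = 1 + sinh s K + (cosh s - 1) K\<^sup>2\<close>.\<close>

definition coset_boost where
  "coset_boost p s Z = Z + (cosh s - 1) *\<^sub>R coset_var p (coset_var p Z) + sinh s *\<^sub>R coset_var p Z"

lemma coset_boost_is_coset_exp:
  fixes p :: "complex \<times> (complex ^ ('n::finite) ^ 4 ^ 4)"
  assumes cube: "\<And>Z. Z \<in> charge_space \<Longrightarrow> coset_var p (coset_var p (coset_var p Z)) = coset_var p Z"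
  shows "is_coset_exp (s *\<^sub>R p) (coset_boost p s)"
  unfolding is_coset_exp_def
proof
  fix Z :: "'n charges" assume Z: "Z \<in> charge_space"
  let ?K = "coset_var p"
  let ?\<gamma> = "\<lambda>t. coset_boost p (s * t) Z"
  have "(?\<gamma> has_vector_derivative coset_var (s *\<^sub>R p) (?\<gamma> t)) (at t within {0..1})" for t :: real
  proof -
    have "coset_var (s *\<^sub>R p) (?\<gamma> t) = s *\<^sub>R (?K Z + (cosh (s * t) - 1) *\<^sub>R ?K Z + sinh (s * t) *\<^sub>R ?K (?K Z))"
      by (simp add: coset_boost_def coset_var_scaleR linear_add[OF coset_var_linear]
          linear_scale[OF coset_var_linear] cube[OF Z] scaleR_right_distrib mult.commute)
    also have "\<dots> = (sinh (s * t) * s) *\<^sub>R ?K (?K Z) + (cosh (s * t) * s) *\<^sub>R ?K Z"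
      by (simp add: algebra_simps)
    finally have eq: "coset_var (s *\<^sub>R p) (?\<gamma> t) = \<dots>" .
    show ?thesis
      unfolding eq unfolding coset_boost_def has_vector_derivative_def
      by (auto intro!: derivative_eq_intros simp: algebra_simps)
  qed
  moreover have "?\<gamma> 0 = Z" "?\<gamma> 1 = coset_boost p s Z"
    by (simp_all add: coset_boost_def)
  ultimately show "\<exists>\<gamma>. \<gamma> 0 = Z \<and> \<gamma> 1 = coset_boost p s Z \<and>
      (\<forall>t\<in>{0..1}. (\<gamma> has_vector_derivative coset_var (s *\<^sub>R p) (\<gamma> t)) (at t within {0..1}))"
    by (intro exI[of _ ?\<gamma>]) simp
qed

section \<open>Reachability and skew-diagonal representatives\<close>

definition reach :: "('n::finite) charges \<Rightarrow> 'n charges \<Rightarrow> bool" where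
  "reach Z Z' \<longleftrightarrow> (\<exists>g\<in>O6n. g Z = Z')"

lemma generator_in_generated: "b \<in> B \<Longrightarrow> b \<in> generated B"
  using generated_comp[OF _ generated_id] by (metis comp_id)

lemma generated_compose:
  assumes "f \<in> generated B" "g \<in> generated B"
  shows "f \<circ> g \<in> generated B"
  using assms(1)
proof induction
  case (generated_comp b f)
  then show ?case by (metis comp_assoc generated.generated_comp)
qed (use assms(2) in simp)

lemma reach_refl: "reach Z Z"
  unfolding reach_def O6n_def using generated_id by (metis id_apply)

lemma reach_trans: "reach Z Z' \<Longrightarrow> reach Z' Z'' \<Longrightarrow> reach Z Z''"
  unfolding reach_def O6n_def using generated_compose by (metis comp_apply)

lemma reach_generator: "g \<in> O6n_generators \<Longrightarrow> reach Z (g Z)"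
  unfolding reach_def O6n_def using generator_in_generated by blast

lemma reach_invariants:
  assumes "reach Z Z'" "Z \<in> charge_space"
  shows "Z' \<in> charge_space" "I1 Z' = I1 Z" "I2 Z' = I2 Z"
    "invariant_under O6n F \<Longrightarrow> F Z' = F Z"
proof -
  obtain g where "g \<in> O6n" "Z' = g Z" using assms(1) unfolding reach_def by blast
  then show "Z' \<in> charge_space" "I1 Z' = I1 Z" "I2 Z' = I2 Z" "invariant_under O6n F \<Longrightarrow> F Z' = F Z"
    using O6n_invariants[OF _ assms(2)] assms(2) by (simp_all add: invariant_under_def)
qed

lemma skew_diag_charge_space: "(skew_diag z w, y) \<in> charge_space"
  unfolding charge_space_iff fst_conv by (rule skew_diag_skew)

lemma skew_diag_I1_I2:
  "I1 (skew_diag z w, y) = (cmod z)\<^sup>2 + (cmod w)\<^sup>2 - (\<Sum>I\<in>UNIV. (cmod (y $ I))\<^sup>2)"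
  "I2 (skew_diag z w, y) = 2 * z * w - (\<Sum>I\<in>UNIV. cnj (y $ I) * cnj (y $ I))"
  by (simp_all add: I1_coords[OF skew_diag_charge_space] I2_coords[OF skew_diag_charge_space])

lemma unitary_mult:
  assumes "unitary_matrix U" "unitary_matrix V"
  shows "unitary_matrix (U ** V)"
proof -
  have "(U ** V) ** adjoint_matrix (U ** V) = U ** (V ** adjoint_matrix V) ** adjoint_matrix U"
    by (simp add: adjoint_eq cnjm_mult matrix_transpose_mul matrix_mul_assoc)
  also have "\<dots> = mat 1" using assms by (simp add: unitary_matrix_def)
  finally show ?thesis unfolding unitary_matrix_def using matrix_left_right_inverse by blast
qed

text \<open>The unitary normal form need not have determinant one. Correcting the phase in the third
  row affects only \<open>w\<close> and keeps \<open>\<sigma>\<close> real.\<close>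

lemma reach_skew_diag:
  fixes Z :: "('n::finite) charges"
  assumes Z: "Z \<in> charge_space"
  obtains \<sigma> w where "reach Z (skew_diag (of_real \<sigma>) w, snd Z)" "cmod w \<le> \<sigma>"
proof -
  obtain U \<sigma> w where U: "unitary_matrix U" and D: "U ** fst Z ** transpose U = skew_diag (of_real \<sigma>) w"
    and w: "cmod w \<le> \<sigma>"
    using skew_normal_form[OF Z[unfolded charge_space_iff]] by metis
  define d where "d = cnj (det U)"
  have d: "cmod d = 1" using unitary_cmod_det[OF U] by (simp add: d_def)
  then have dd: "d * cnj d = 1" by (simp add: complex_norm_square[symmetric])
  define E :: "complex ^ 4 ^ 4" where "E = (\<chi> i j. if i = j then (if i = 3 then d else 1) else 0)"
  have "unitary_matrix E"
    unfolding unitary_matrix_def vec_eq_iff forall_4 using dd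
    by (simp add: E_def matrix_matrix_mult_def adjoint_matrix_def sum_4 mat_def mult.commute)
  moreover have "det E = d" unfolding det_4 by (simp add: E_def)
  ultimately have "E ** U \<in> SU4"
    using dd U by (simp add: SU4_def unitary_mult det_mul d_def mult.commute)
  then have "isotropy (E ** U) (mat 1) 1 \<in> (O6n_generators :: ('n charges \<Rightarrow> 'n charges) set)"
    unfolding O6n_generators_def using orthogonal_matrix_id by blast
  moreover have "isotropy (E ** U) (mat 1) 1 Z = (skew_diag (of_real \<sigma>) (d * w), snd Z)"
  proof -
    have "(E ** U) ** fst Z ** transpose (E ** U) = E ** (U ** fst Z ** transpose U) ** transpose E"
      by (simp add: matrix_transpose_mul matrix_mul_assoc)
    also have "\<dots> = skew_diag (of_real \<sigma>) (d * w)"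
      unfolding D
      by (rule skew_eqI[OF congruence_skew_skew[OF skew_diag_skew] skew_diag_skew];
          unfold congruence_skew[OF skew_diag_skew]) (simp_all add: E_def)
    finally show ?thesis
      by (simp add: isotropy_def vec_eq_iff prod_eq_iff mat_def if_distrib[of of_real]
          if_distrib[of "\<lambda>x. x * _"] cong: if_cong)
  qed
  ultimately have "reach Z (skew_diag (of_real \<sigma>) (d * w), snd Z)"
    by (metis reach_generator)
  moreover have "cmod (d * w) \<le> \<sigma>" using w d by (simp add: norm_mult)
  ultimately show ?thesis using that by blast
qed

section \<open>Boosts that remove the matter charges\<close>

lemma self_dual_skew_diag: "self_dual (skew_diag \<tau> (cnj \<tau>))"
  unfolding self_dual_def by (intro conjI skew_diag_skew) simp_all

text \<open>A boost in the plane of the positive vector \<open>skew_diag \<tau> (cnj \<tau>)\<close>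
  and the negative vector \<open>v\<close>. The normalisations make both unit vectors, which gives
  \<open>K\<^sup>3 = K\<close>. The components along them are
  \<open>cnj \<tau> * z + \<tau> * w\<close> and \<open>b y\<close>; real and imaginary parts belong
  to the two real vectors of the pair.\<close>

lemma reach_boost:
  fixes v :: "real ^ ('n::finite)"
  assumes \<tau>: "2 * (cmod \<tau>)\<^sup>2 = 1" and v: "norm v = 1"
  defines "b \<equiv> \<lambda>y :: complex ^ 'n. \<Sum>I\<in>UNIV. of_real (v $ I) * cnj (y $ I)"
  shows "reach (skew_diag z w, y)
     (skew_diag (z + \<tau> * (of_real (cosh s - 1) * (cnj \<tau> * z + \<tau> * w) + of_real (sinh s) * b y))
        (w + cnj \<tau> * (of_real (cosh s - 1) * (cnj \<tau> * z + \<tau> * w) + of_real (sinh s) * b y)),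
      \<chi> I. y $ I + of_real (v $ I) *
        cnj (of_real (cosh s - 1) * b y + of_real (sinh s) * (cnj \<tau> * z + \<tau> * w)))"
proof -
  define T where "T = skew_diag \<tau> (cnj \<tau>)"
  define p where "p = (0 :: complex, \<chi> A B I. T $ A $ B * of_real (v $ I))"
  define c where "c = (\<lambda>x :: complex ^ 4 ^ 4. 1/2 * (\<Sum>A\<in>UNIV. \<Sum>B\<in>UNIV. T $ A $ B * cnj (x $ A $ B)))"
  have var: "coset_var p Z = (\<chi> A B. T $ A $ B * b (snd Z), \<chi> I. of_real (v $ I) * c (fst Z))" for Z
    unfolding p_def coset_var_rank_one b_def c_def ..
  have \<tau>': "2 * (\<tau> * cnj \<tau>) = 1"
    using \<tau> by (metis complex_norm_square of_real_1 of_real_mult of_real_numeral)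
  have c: "c (\<chi> A B. T $ A $ B * m) = cnj m" for m
    using \<tau>' by (simp add: c_def T_def sum_4 algebra_simps)
  have "(\<Sum>I\<in>UNIV. v $ I * v $ I) = 1"
    using v by (simp add: norm_eq_1 inner_vec_def)
  then have "(\<Sum>I\<in>UNIV. complex_of_real (v $ I * v $ I)) = 1"
    unfolding of_real_sum[symmetric] by simp
  then have b: "b (\<chi> I. of_real (v $ I) * m) = cnj m" for m
    by (simp add: b_def mult.assoc[symmetric] sum_distrib_right[symmetric])
  have "coset_var p (coset_var p (coset_var p Z)) = coset_var p Z" for Z
    unfolding var fst_conv snd_conv b c by simp
  from coset_boost_is_coset_exp[OF this]
  have "is_coset_exp (s *\<^sub>R p) (coset_boost p s)" .
  moreover have "s *\<^sub>R p = (0, \<chi> A B I. T $ A $ B * of_real ((s *\<^sub>R v) $ I))"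
    by (simp add: p_def vec_eq_iff scaleR_conv_of_real[where 'a=complex] mult_ac)
  moreover have "\<dots> \<in> coset_params"
    unfolding T_def by (rule self_dual_coset_params[OF self_dual_skew_diag])
  ultimately have "coset_boost p s \<in> O6n_generators"
    unfolding O6n_generators_def by auto
  then have "reach (skew_diag z w, y) (coset_boost p s (skew_diag z w, y))"
    by (rule reach_generator)
  moreover have cZ: "c (skew_diag z w) = cnj (cnj \<tau> * z + \<tau> * w)"
    by (simp add: c_def T_def sum_4 algebra_simps)
  have "fst (coset_boost p s (skew_diag z w, y)) =
     skew_diag (z + \<tau> * (of_real (cosh s - 1) * (cnj \<tau> * z + \<tau> * w) + of_real (sinh s) * b y))
        (w + cnj \<tau> * (of_real (cosh s - 1) * (cnj \<tau> * z + \<tau> * w) + of_real (sinh s) * b y))"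
    unfolding coset_boost_def var fst_conv snd_conv b cZ vec_eq_iff forall_4
    by (simp add: T_def scaleR_conv_of_real[where 'a=complex] algebra_simps)
  moreover have "snd (coset_boost p s (skew_diag z w, y)) = (\<chi> I. y $ I + of_real (v $ I) *
        cnj (of_real (cosh s - 1) * b y + of_real (sinh s) * (cnj \<tau> * z + \<tau> * w)))"
    unfolding coset_boost_def var fst_conv snd_conv c cZ
    by (simp add: vec_eq_iff scaleR_conv_of_real[where 'a=complex] algebra_simps)
  ultimately show ?thesis by (metis prod.collapse)
qed

text \<open>The solution of \<open>tanh s = - B / A\<close>, written as
  \<open>exp (2 * s) = (A - B) / (A + B)\<close>.\<close>

lemma exists_rapidity:
  fixes A B :: real
  assumes "\<bar>B\<bar> < \<bar>A\<bar>"
  obtains s where "A * sinh s + B * cosh s = 0"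
proof -
  have pos: "0 < (A - B) / (A + B)"
    using assms by (auto simp: zero_less_divide_iff abs_if split: if_splits)
  define s where "s = ln ((A - B) / (A + B)) / 2"
  have "exp s * exp s = (A - B) / (A + B)"
    using pos by (simp add: s_def exp_add[symmetric])
  then have "(A + B) * (exp s * exp s) = A - B"
    using pos by (cases "A + B = 0") simp_all
  then have "(A + B) * exp s = (A - B) * exp (- s)"
    by (simp add: exp_minus field_simps)
  then have "A * sinh s + B * cosh s = 0"
    by (simp add: sinh_def cosh_def algebra_simps)
  then show ?thesis using that by blast
qed

lemma norm_vec_power2: "(norm (x :: real ^ 'n::finite))\<^sup>2 = (\<Sum>I\<in>UNIV. (x $ I)\<^sup>2)"
  unfolding power2_norm_eq_inner inner_vec_def by (simp add: power2_eq_square)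

text \<open>Rescales \<open>u\<close> to modulus \<open>1 / sqrt 2\<close>, the normalisation of
  \<open>\<tau>\<close> in \<open>reach_boost\<close>.\<close>

lemma half_unit:
  assumes "u \<noteq> 0"
  defines "k \<equiv> 1 / (sqrt 2 * cmod u)"
  shows "2 * (cmod (of_real k * (u :: complex)))\<^sup>2 = 1" "k > 0" "2 * (k * (cmod u)\<^sup>2)\<^sup>2 = (cmod u)\<^sup>2"
    "2 * k\<^sup>2 * (cmod u)\<^sup>2 = 1"
  using assms by (simp_all add: norm_mult norm_divide power_mult_distrib power_divide field_simps power2_eq_square)

text \<open>The first real vector of the pair has positive part given by \<open>u\<close> and
  negative part \<open>c\<close>; its square \<open>(I1 + Re I2) / 2\<close> is positive. Boosting
  in the plane of its own two parts therefore removes the negative one.\<close>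

lemma reach_Re_zero:
  fixes y :: "complex ^ ('n::finite)"
  assumes pos: "cmod (I2 (skew_diag z w, y)) < I1 (skew_diag z w, y)"
  obtains z' w' y' where "reach (skew_diag z w, y) (skew_diag z' w', y')" "\<forall>I. Re (y' $ I) = 0"
proof (cases "\<forall>I. Re (y $ I) = 0")
  case True
  then show ?thesis using that reach_refl by blast
next
  case False
  define c :: "real ^ 'n" where "c = (\<chi> I. Re (y $ I))"
  have c0: "norm c > 0" using False by (simp add: c_def vec_eq_iff)
  define v where "v = (1 / norm c) *\<^sub>R c"
  have v: "norm v = 1" using c0 by (simp add: v_def)
  define u where "u = z + cnj w"
  have "0 < I1 (skew_diag z w, y) + Re (I2 (skew_diag z w, y))"
    using pos abs_Re_le_cmod[of "I2 (skew_diag z w, y)"] by linarith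
  also have "\<dots> = (cmod u)\<^sup>2 - 2 * (norm c)\<^sup>2"
  proof -
    have "(\<Sum>I\<in>UNIV. (cmod (y $ I))\<^sup>2) + (\<Sum>I\<in>UNIV. Re (cnj (y $ I) * cnj (y $ I))) = 2 * (norm c)\<^sup>2"
      unfolding norm_vec_power2 sum_distrib_left sum.distrib[symmetric] cmod_power2
      by (intro sum.cong refl) (simp add: c_def power2_eq_square)
    moreover have "(cmod u)\<^sup>2 = (cmod z)\<^sup>2 + (cmod w)\<^sup>2 + 2 * Re (z * w)"
      unfolding u_def cmod_power2 by (simp add: power2_eq_square algebra_simps)
    ultimately show ?thesis
      unfolding skew_diag_I1_I2 minus_complex.simps Re_sum by simp
  qed
  finally have A: "2 * (norm c)\<^sup>2 < (cmod u)\<^sup>2" by simp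
  then have u0: "u \<noteq> 0" using c0 by auto
  define k where "k = 1 / (sqrt 2 * cmod u)"
  note k = half_unit[OF u0, folded k_def]
  define \<tau> where "\<tau> = of_real k * u"
  define \<alpha> where "\<alpha> = cnj \<tau> * z + \<tau> * w"
  have Re\<alpha>: "Re \<alpha> = k * (cmod u)\<^sup>2"
    unfolding cmod_power2 by (simp add: \<alpha>_def \<tau>_def u_def power2_eq_square algebra_simps)
  define b where "b = (\<Sum>I\<in>UNIV. of_real (v $ I) * cnj (y $ I))"
  have "Re b = v \<bullet> c"
    by (simp add: b_def inner_vec_def c_def)
  also have "\<dots> = norm c" using c0 by (simp add: v_def dot_square_norm power2_eq_square)
  finally have Reb: "Re b = norm c" .
  have "(norm c)\<^sup>2 < (Re \<alpha>)\<^sup>2"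
    using A k(3) unfolding Re\<alpha> by linarith
  then have "\<bar>norm c\<bar> < \<bar>Re \<alpha>\<bar>" by - (rule power2_less_imp_less, simp_all)
  then obtain s where s: "Re \<alpha> * sinh s + norm c * cosh s = 0"
    by (rule exists_rapidity)
  define y' where "y' = (\<chi> I. y $ I + of_real (v $ I) * cnj (of_real (cosh s - 1) * b + of_real (sinh s) * \<alpha>))"
  have "Re (y' $ I) = 0" for I
  proof -
    have "Re (y $ I) = norm c * v $ I" using c0 by (simp add: v_def c_def)
    then have "Re (y' $ I) = v $ I * (Re \<alpha> * sinh s + norm c * cosh s)"
      by (simp add: y'_def Reb algebra_simps)
    then show ?thesis by (simp add: s)
  qed
  moreover note reach_boost[of \<tau> v z w y s, OF k(1)[folded \<tau>_def] v, folded \<alpha>_def b_def, folded y'_def]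
  ultimately show ?thesis using that by blast
qed

text \<open>Gram-Schmidt for the second vector: the boost must avoid the first one, so it uses the
  positive direction orthogonal to it.\<close>

lemma reach_Im_zero:
  fixes y :: "complex ^ ('n::finite)"
  assumes pos: "cmod (I2 (skew_diag z w, y)) < I1 (skew_diag z w, y)" and Re0: "\<forall>I. Re (y $ I) = 0"
  obtains z' w' where "reach (skew_diag z w, y) (skew_diag z' w', 0)"
proof (cases "y = 0")
  case True
  then show ?thesis using that reach_refl by blast
next
  case False
  define c :: "real ^ 'n" where "c = (\<chi> I. Im (y $ I))"
  have yc: "y $ I = \<i> * of_real (c $ I)" for I using Re0 by (simp add: c_def complex_eq_iff)
  have c0: "norm c > 0" using False yc by (auto simp: vec_eq_iff)
  define v where "v = (1 / norm c) *\<^sub>R c"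
  have v: "norm v = 1" using c0 by (simp add: v_def)
  define u where "u = z + cnj w"
  have I1: "I1 (skew_diag z w, y) = (cmod z)\<^sup>2 + (cmod w)\<^sup>2 - (norm c)\<^sup>2"
    unfolding skew_diag_I1_I2 norm_vec_power2 yc by (simp add: norm_mult)
  have I2: "I2 (skew_diag z w, y) = 2 * z * w + of_real ((norm c)\<^sup>2)"
    unfolding skew_diag_I1_I2 norm_vec_power2 yc by (simp add: power2_eq_square sum_negf algebra_simps)
  have u2: "(cmod u)\<^sup>2 = (cmod z)\<^sup>2 + (cmod w)\<^sup>2 + 2 * Re (z * w)"
    unfolding u_def cmod_power2 by (simp add: power2_eq_square algebra_simps)
  have "0 < I1 (skew_diag z w, y) + Re (I2 (skew_diag z w, y))"
    using pos abs_Re_le_cmod[of "I2 (skew_diag z w, y)"] by linarith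
  also have "\<dots> = (cmod u)\<^sup>2" unfolding u2 I1 I2 by simp
  finally have u0: "u \<noteq> 0" by auto
  have "(cmod (I2 (skew_diag z w, y)))\<^sup>2 < (I1 (skew_diag z w, y))\<^sup>2"
    using pos by (simp add: power_strict_mono)
  \<comment> \<open>\<open>I1\<^sup>2 - \<bar>I2\<bar>\<^sup>2\<close> is four times the Gram
    determinant. Its positivity says that \<open>c\<close> is shorter than the component of the
    second vector along the direction chosen below.\<close>
  also have "(I1 (skew_diag z w, y))\<^sup>2 = (cmod (I2 (skew_diag z w, y)))\<^sup>2 +
      ((cmod z)\<^sup>2 - (cmod w)\<^sup>2)\<^sup>2 - 2 * (norm c)\<^sup>2 * (cmod u)\<^sup>2"
    unfolding u2 I1 I2 unfolding cmod_power2 by (simp add: power2_eq_square algebra_simps)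
  finally have A: "2 * (norm c)\<^sup>2 * (cmod u)\<^sup>2 < ((cmod z)\<^sup>2 - (cmod w)\<^sup>2)\<^sup>2" by simp
  define k where "k = 1 / (sqrt 2 * cmod u)"
  note k = half_unit[OF u0, folded k_def]
  \<comment> \<open>The factor \<open>\<i>\<close> makes this direction orthogonal to that of
    \<open>u\<close>; hence \<open>\<alpha>\<close> is purely imaginary and \<open>Re y\<close>
    stays zero.\<close>
  define \<tau> where "\<tau> = of_real k * (\<i> * u)"
  have \<tau>: "2 * (cmod \<tau>)\<^sup>2 = 1" using k(1) by (simp add: \<tau>_def norm_mult)
  define \<alpha> where "\<alpha> = cnj \<tau> * z + \<tau> * w"
  define a where "a = k * ((cmod w)\<^sup>2 - (cmod z)\<^sup>2)"
  have \<alpha>: "\<alpha> = \<i> * of_real a"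
    unfolding a_def cmod_power2
    by (simp add: complex_eq_iff \<alpha>_def \<tau>_def u_def power2_eq_square algebra_simps)
  define b where "b = (\<Sum>I\<in>UNIV. of_real (v $ I) * cnj (y $ I))"
  have "b = - \<i> * of_real (v \<bullet> c)"
    unfolding b_def yc inner_vec_def by (simp add: sum_distrib_left sum_negf mult_ac)
  also have "v \<bullet> c = norm c" using c0 by (simp add: v_def dot_square_norm power2_eq_square)
  finally have b: "b = - \<i> * of_real (norm c)" .
  have "(norm c)\<^sup>2 < a\<^sup>2"
  proof -
    have "k\<^sup>2 * (2 * (norm c)\<^sup>2 * (cmod u)\<^sup>2) < k\<^sup>2 * ((cmod z)\<^sup>2 - (cmod w)\<^sup>2)\<^sup>2"
      using A k(2) by simp
    moreover have "k\<^sup>2 * (2 * (norm c)\<^sup>2 * (cmod u)\<^sup>2) = (2 * k\<^sup>2 * (cmod u)\<^sup>2) * (norm c)\<^sup>2" by simp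
    ultimately show ?thesis unfolding k(4) a_def power_mult_distrib by (simp add: power2_commute)
  qed
  then have "\<bar>norm c\<bar> < \<bar>- a\<bar>" by - (rule power2_less_imp_less, simp_all)
  then obtain s where s: "- a * sinh s + norm c * cosh s = 0"
    by (rule exists_rapidity)
  have "y $ I + of_real (v $ I) * cnj (of_real (cosh s - 1) * b + of_real (sinh s) * \<alpha>) = 0" for I
  proof -
    have "c $ I = norm c * v $ I" using c0 by (simp add: v_def)
    then have "y $ I + of_real (v $ I) * cnj (of_real (cosh s - 1) * b + of_real (sinh s) * \<alpha>)
       = \<i> * of_real (v $ I * (- a * sinh s + norm c * cosh s))"
      unfolding yc b \<alpha> by (simp add: algebra_simps)
    then show ?thesis unfolding s by simp
  qed
  then have "(\<chi> I. y $ I + of_real (v $ I) * cnj (of_real (cosh s - 1) * b + of_real (sinh s) * \<alpha>)) = 0"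
    by (simp add: vec_eq_iff)
  moreover note reach_boost[of \<tau> v z w y s, OF \<tau> v, folded \<alpha>_def b_def]
  ultimately show ?thesis using that by metis
qed

lemma reach_canonical:
  fixes Z :: "('n::finite) charges"
  assumes Z: "Z \<in> charge_space" and pos: "cmod (I2 Z) < I1 Z"
  obtains \<sigma> w where "reach Z (skew_diag (of_real \<sigma>) w, 0)" "cmod w \<le> \<sigma>"
proof -
  obtain z1 w1 where 1: "reach Z (skew_diag z1 w1, snd Z)"
    using reach_skew_diag[OF Z] by metis
  have "cmod (I2 (skew_diag z1 w1, snd Z)) < I1 (skew_diag z1 w1, snd Z)"
    using reach_invariants[OF 1 Z] pos by simp
  then obtain z2 w2 y2 where "reach (skew_diag z1 w1, snd Z) (skew_diag z2 w2, y2)" and y2: "\<forall>I. Re (y2 $ I) = 0"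
    using reach_Re_zero by metis
  with 1 have 2: "reach Z (skew_diag z2 w2, y2)" using reach_trans by blast
  have "cmod (I2 (skew_diag z2 w2, y2)) < I1 (skew_diag z2 w2, y2)"
    using reach_invariants[OF 2 Z] pos by simp
  then obtain z3 w3 where "reach (skew_diag z2 w2, y2) (skew_diag z3 w3, 0)"
    using reach_Im_zero y2 by metis
  with 2 have 3: "reach Z (skew_diag z3 w3, 0)" using reach_trans by blast
  \<comment> \<open>The boosts destroy the real, ordered form of the diagonal, so the normal form is
    applied once more.\<close>
  obtain \<sigma> w where "reach (skew_diag z3 w3, 0 :: complex ^ 'n) (skew_diag (of_real \<sigma>) w, 0)" "cmod w \<le> \<sigma>"
    using reach_skew_diag[OF skew_diag_charge_space[of z3 w3 0]] by (metis snd_conv)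
  with 3 show ?thesis using reach_trans that by blast
qed

text \<open>With \<open>y = 0\<close>, \<open>I1\<close> and \<open>I2\<close> are
  \<open>\<sigma>\<^sup>2 + \<bar>w\<bar>\<^sup>2\<close> and \<open>2 \<sigma> w\<close>, and the
  ordering \<open>\<bar>w\<bar> \<le> \<sigma>\<close> makes this invertible. Both charges reach the
  same canonical form, so symmetry of \<open>reach\<close> does not enter.\<close>

lemma O6n_separation:
  fixes Z Z' :: "('n::finite) charges"
  assumes F: "invariant_under O6n F" and Z: "Z \<in> charge_space" and Z': "Z' \<in> charge_space"
    and pos: "cmod (I2 Z) < I1 Z" and eq: "I1 Z = I1 Z'" "I2 Z = I2 Z'"
  shows "F Z = F Z'"
proof -
  obtain \<sigma> w where c: "reach Z (skew_diag (of_real \<sigma>) w, 0)" "cmod w \<le> \<sigma>"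
    using reach_canonical[OF Z pos] by metis
  obtain \<sigma>' w' where c': "reach Z' (skew_diag (of_real \<sigma>') w', 0)" "cmod w' \<le> \<sigma>'"
    using reach_canonical[OF Z'] pos eq by metis
  have "\<sigma>\<^sup>2 + (cmod w)\<^sup>2 = \<sigma>'\<^sup>2 + (cmod w')\<^sup>2" "2 * (of_real \<sigma> * w) = 2 * (of_real \<sigma>' * w')"
    using reach_invariants(2,3)[OF c(1) Z] reach_invariants(2,3)[OF c'(1) Z'] eq
    by (simp_all add: skew_diag_I1_I2 mult.assoc)
  then have 1: "\<sigma>\<^sup>2 + (cmod w)\<^sup>2 = \<sigma>'\<^sup>2 + (cmod w')\<^sup>2" "of_real \<sigma> * w = of_real \<sigma>' * w'"
    by (simp_all only: mult_cancel_left) simp_all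
  have nn: "0 \<le> \<sigma>" "0 \<le> \<sigma>'" using c(2) c'(2) norm_ge_zero order_trans by blast+
  have "\<sigma> * cmod w = \<sigma>' * cmod w'"
    using arg_cong[OF 1(2), of cmod] nn by (simp add: norm_mult)
  then have "(\<sigma>\<^sup>2 - (cmod w)\<^sup>2)\<^sup>2 = (\<sigma>'\<^sup>2 - (cmod w')\<^sup>2)\<^sup>2"
    using 1(1) by algebra
  moreover have "0 \<le> \<sigma>\<^sup>2 - (cmod w)\<^sup>2" "0 \<le> \<sigma>'\<^sup>2 - (cmod w')\<^sup>2"
    using c(2) c'(2) by (simp_all add: power_mono)
  ultimately have "\<sigma>\<^sup>2 - (cmod w)\<^sup>2 = \<sigma>'\<^sup>2 - (cmod w')\<^sup>2"
    by (metis power2_eq_iff_nonneg)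
  with 1(1) have "\<sigma>\<^sup>2 = \<sigma>'\<^sup>2" by linarith
  then have \<sigma>: "\<sigma> = \<sigma>'" using nn by (simp add: power2_eq_iff_nonneg)
  have "w = w'"
  proof (cases "\<sigma> = 0")
    case True
    then show ?thesis using c(2) c'(2) \<sigma> by simp
  next
    case False
    then show ?thesis using 1(2) \<sigma> by simp
  qed
  then have "reach Z' (skew_diag (of_real \<sigma>) w, 0)" using c'(1) \<sigma> by simp
  then show ?thesis
    using reach_invariants(4)[OF c(1) Z F] reach_invariants(4)[OF _ Z' F] by metis
qed

section \<open>Orbits of the U-duality group\<close>

lemma coset_var_xi_involutive:
  assumes "Z \<in> charge_space"
  shows "coset_var (1, 0) (coset_var (1, 0) Z) = Z"
proof -
  note sk = coset_var_in_charge_space[OF zero_Xi_in_coset_params]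
  have "fst (coset_var (1, 0) (coset_var (1, 0) Z)) = fst Z"
    by (rule skew_eqI[OF sk[unfolded charge_space_iff] assms[unfolded charge_space_iff]];
        unfold coset_var_coords[OF sk zero_Xi_in_coset_params] coset_var_coords[OF assms zero_Xi_in_coset_params])
       simp_all
  moreover have "snd (coset_var (1, 0) (coset_var (1, 0) Z)) = snd Z"
    unfolding vec_eq_iff coset_var_coords[OF sk zero_Xi_in_coset_params]
      coset_var_coords[OF assms zero_Xi_in_coset_params] by simp
  ultimately show ?thesis by (simp add: prod_eq_iff)
qed

text \<open>On \<open>(I1, Re I2)\<close> this is a Lorentz boost of rapidity \<open>2 * s\<close>,
  with \<open>Im I2\<close> fixed: the double cover of \<open>SO(1,2)\<close> by
  \<open>SU(1,1)\<close>.\<close>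

lemma coset_boost_1:
  fixes Z :: "('n::finite) charges"
  assumes Z: "Z \<in> charge_space"
  shows "coset_boost (1, 0) s \<in> (U_duality :: ('n charges \<Rightarrow> 'n charges) set)"
    "I2 (coset_boost (1, 0) s Z) = of_real ((cosh s)\<^sup>2) * I2 Z + of_real ((sinh s)\<^sup>2) * cnj (I2 Z)
       + of_real (2 * sinh s * cosh s * I1 Z)"
    "I1 (coset_boost (1, 0) s Z) = ((cosh s)\<^sup>2 + (sinh s)\<^sup>2) * I1 Z + 2 * sinh s * cosh s * Re (I2 Z)"
proof -
  have "is_coset_exp (s *\<^sub>R (1, 0)) (coset_boost (1, 0) s :: 'n charges \<Rightarrow> 'n charges)"
    by (rule coset_boost_is_coset_exp) (simp add: coset_var_xi_involutive)
  then have "coset_boost (1, 0) s \<in> (SU11_generators :: ('n charges \<Rightarrow> 'n charges) set)"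
    unfolding SU11_generators_def by auto
  then have g: "coset_boost (1, 0) s \<in> (U_duality :: ('n charges \<Rightarrow> 'n charges) set)"
    unfolding U_duality_def by (intro generator_in_generated UnI1)
  then show "coset_boost (1, 0) s \<in> (U_duality :: ('n charges \<Rightarrow> 'n charges) set)" .
  have Z': "coset_boost (1, 0) s Z \<in> charge_space" by (rule U_duality_invariants(1)[OF g Z])
  have eq: "coset_boost (1, 0) s Z = cosh s *\<^sub>R Z + sinh s *\<^sub>R coset_var (1, 0) Z"
    by (simp add: coset_boost_def coset_var_xi_involutive[OF Z] algebra_simps)
  note coords = coset_var_coords[OF Z zero_Xi_in_coset_params]
  show "I2 (coset_boost (1, 0) s Z) = of_real ((cosh s)\<^sup>2) * I2 Z + of_real ((sinh s)\<^sup>2) * cnj (I2 Z)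
       + of_real (2 * sinh s * cosh s * I1 Z)"
    unfolding I2_coords[OF Z'] I2_coords[OF Z] I1_coords[OF Z] unfolding eq
    by (simp add: coords pf_def scaleR_conv_of_real[where 'a=complex] power2_eq_square
       complex_norm_square[unfolded power2_eq_square of_real_mult] sum.distrib sum_distrib_left sum_distrib_right algebra_simps)
  have "complex_of_real (I1 (coset_boost (1, 0) s Z)) =
      of_real ((cosh s)\<^sup>2 + (sinh s)\<^sup>2) * of_real (I1 Z) + of_real (sinh s * cosh s) * (I2 Z + cnj (I2 Z))"
    unfolding I2_coords[OF Z] I1_coords[OF Z] I1_coords[OF Z'] unfolding eq
    by (simp add: coords pf_def scaleR_conv_of_real[where 'a=complex] power2_eq_square
       complex_norm_square[unfolded power2_eq_square of_real_mult] sum.distrib sum_distrib_left sum_distrib_right algebra_simps)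
  also have "\<dots> = of_real (((cosh s)\<^sup>2 + (sinh s)\<^sup>2) * I1 Z + 2 * sinh s * cosh s * Re (I2 Z))"
    by (simp add: complex_add_cnj)
  finally show "I1 (coset_boost (1, 0) s Z) = ((cosh s)\<^sup>2 + (sinh s)\<^sup>2) * I1 Z + 2 * sinh s * cosh s * Re (I2 Z)"
    by (simp only: of_real_eq_iff)
qed

text \<open>\<open>(I1, I2)\<close> is a future-pointing timelike vector of
  \<open>\<real>\<^sup>1\<^sup>,\<^sup>2\<close>: rotate \<open>I2\<close> to the real axis, then
  boost to the rest frame.\<close>

lemma U_duality_normalise:
  fixes Z :: "('n::finite) charges"
  assumes Z: "Z \<in> charge_space" and pos: "cmod (I2 Z) < I1 Z"
  obtains g where "g \<in> U_duality" "I2 (g Z) = 0" "I1 (g Z) = sqrt (disc Z)"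
proof -
  \<comment> \<open>A square root of the inverse phase, because \<open>I2\<close> rotates by
    \<open>c\<^sup>2\<close>.\<close>
  define c where "c = (if I2 Z = 0 then 1 else cnj (csqrt (sgn (I2 Z))))"
  have "(cmod (csqrt (sgn (I2 Z))))\<^sup>2 = cmod (sgn (I2 Z))"
    by (simp add: norm_power[symmetric])
  then have c: "cmod c = 1"
    by (auto simp: c_def norm_sgn power2_eq_1_iff)
  have c2: "c\<^sup>2 * I2 Z = of_real (cmod (I2 Z))"
  proof (cases "I2 Z = 0")
    case False
    then have "c\<^sup>2 = cnj (sgn (I2 Z))" unfolding c_def by (simp add: complex_cnj_power[symmetric])
    moreover have "cnj (I2 Z) * I2 Z = of_real (cmod (I2 Z)) * of_real (cmod (I2 Z))"
      using complex_norm_square[of "I2 Z"] by (simp add: power2_eq_square mult.commute)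
    ultimately show ?thesis using False by (simp add: sgn_eq)
  qed simp
  define f where "f = (isotropy (mat 1) (mat 1) c :: 'n charges \<Rightarrow> 'n charges)"
  have "f \<in> SU11_generators" using c unfolding f_def SU11_generators_def by blast
  then have f: "f \<in> U_duality"
    unfolding U_duality_def by (intro generator_in_generated UnI1)
  have fZ: "f Z \<in> charge_space" by (rule U_duality_invariants(1)[OF f Z])
  have I1f: "I1 (f Z) = I1 Z" unfolding f_def by (rule isotropy_I1) (simp_all add: c orthogonal_matrix_id)
  have I2f: "I2 (f Z) = of_real (cmod (I2 Z))"
    unfolding f_def c2[symmetric] by (rule isotropy_I2[OF Z]) (simp_all add: c orthogonal_matrix_id)
  have "\<bar>cmod (I2 Z)\<bar> < \<bar>I1 Z\<bar>" using pos by simp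
  then obtain t where t: "I1 Z * sinh t + cmod (I2 Z) * cosh t = 0"
    by (rule exists_rapidity)
  \<comment> \<open>Half of \<open>t\<close>, since the rapidity doubles on
    \<open>(I1, I2)\<close>.\<close>
  let ?h = "coset_boost (1, 0) (t / 2) :: 'n charges \<Rightarrow> 'n charges"
  note h = coset_boost_1[OF fZ, of "t / 2"]
  have dbl: "cosh t = (cosh (t/2))\<^sup>2 + (sinh (t/2))\<^sup>2" "sinh t = 2 * sinh (t/2) * cosh (t/2)"
    using cosh_double[of "t/2"] sinh_double[of "t/2"] by simp_all
  have "I2 (?h (f Z)) = of_real (((cosh (t/2))\<^sup>2 + (sinh (t/2))\<^sup>2) * cmod (I2 Z) + 2 * sinh (t/2) * cosh (t/2) * I1 Z)"
    unfolding h I2f I1f by (simp add: algebra_simps)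
  also have "\<dots> = of_real (I1 Z * sinh t + cmod (I2 Z) * cosh t)"
    unfolding dbl by (simp add: algebra_simps)
  finally have I2: "I2 ((?h \<circ> f) Z) = 0" by (simp add: t)
  have "I1 (?h (f Z)) = cosh t * I1 Z + sinh t * cmod (I2 Z)"
    unfolding h I2f I1f dbl by simp
  \<comment> \<open>Keeps the new \<open>I1\<close> positive, which selects the positive root of
    \<open>disc Z\<close>.\<close>
  moreover have "- (cosh t * cmod (I2 Z)) \<le> sinh t * cmod (I2 Z)"
    using mult_right_mono[OF sinh_le_cosh_real[of "- t"] norm_ge_zero[of "I2 Z"]] by simp
  moreover have "cosh t * cmod (I2 Z) < cosh t * I1 Z" using pos by (simp add: cosh_real_pos)
  ultimately have I1: "I1 ((?h \<circ> f) Z) > 0" unfolding comp_apply by linarith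
  have g: "?h \<circ> f \<in> U_duality"
    using generated_compose h(1) f unfolding U_duality_def by blast
  have "disc Z = (I1 ((?h \<circ> f) Z))\<^sup>2"
    using U_duality_invariants(2)[OF g Z] I2 by (simp add: disc_def)
  then show ?thesis using that[OF g I2] I1 by simp
qed

lemma U_duality_separation:
  fixes Z Z' :: "('n::finite) charges"
  assumes F: "invariant_under U_duality F" and Z: "Z \<in> charge_space" and Z': "Z' \<in> charge_space"
    and pos: "cmod (I2 Z) < I1 Z" "cmod (I2 Z') < I1 Z'" and eq: "disc Z = disc Z'"
  shows "F Z = F Z'"
proof -
  obtain g where g: "g \<in> U_duality" "I2 (g Z) = 0" "I1 (g Z) = sqrt (disc Z)"
    using U_duality_normalise[OF Z pos(1)] .
  obtain g' where g': "g' \<in> U_duality" "I2 (g' Z') = 0" "I1 (g' Z') = sqrt (disc Z')"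
    using U_duality_normalise[OF Z' pos(2)] .
  have "disc Z > 0" using pos(1) by (simp add: disc_def power_strict_mono)
  moreover have "invariant_under O6n F"
    using F O6n_subset_U_duality unfolding invariant_under_def by blast
  ultimately have "F (g Z) = F (g' Z')"
    by - (rule O6n_separation, assumption, rule U_duality_invariants(1)[OF g(1) Z],
      rule U_duality_invariants(1)[OF g'(1) Z'], simp_all add: g g' eq)
  then show ?thesis using F g(1) g'(1) Z Z' unfolding invariant_under_def by metis
qed

section \<open>Polynomial invariants\<close>

lemma polynomial_function_linear_compose:
  assumes "bounded_linear h" "polynomial_function f"
  shows "polynomial_function (\<lambda>x. h (f x))"
  using polynomial_function_compose[OF assms(2) polynomial_function_bounded_linear[OF assms(1)]]
  by (simp add: o_def)

text \<open>\<open>polynomial_function\<close> means polynomial in real coordinates, so the complex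
  product is expanded into real multiples of \<open>g\<close> and \<open>\<i> * g\<close>.\<close>

lemma polynomial_function_mult_complex:
  fixes f g :: "'a::real_normed_vector \<Rightarrow> complex"
  assumes f: "polynomial_function f" and g: "polynomial_function g"
  shows "polynomial_function (\<lambda>x. f x * g x)"
proof -
  have "(\<lambda>x. f x * g x) = (\<lambda>x. Re (f x) *\<^sub>R g x + Im (f x) *\<^sub>R (\<i> * g x))"
    by (rule ext) (simp add: complex_eq_iff)
  moreover have "polynomial_function (\<lambda>x. Re (f x) *\<^sub>R g x + Im (f x) *\<^sub>R (\<i> * g x))"
    by (intro polynomial_function_add polynomial_function_mult g f
        polynomial_function_linear_compose[OF bounded_linear_Re] polynomial_function_linear_compose[OF bounded_linear_Im]
        polynomial_function_linear_compose[OF bounded_linear_mult_right])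
  ultimately show ?thesis by simp
qed

lemma polynomial_function_Pair:
  fixes f :: "'a::real_normed_vector \<Rightarrow> 'b::real_normed_vector" and g :: "'a \<Rightarrow> 'c::real_normed_vector"
  assumes "polynomial_function f" "polynomial_function g"
  shows "polynomial_function (\<lambda>x. (f x, g x))"
proof -
  have bl: "bounded_linear (\<lambda>y :: 'b. (y, 0 :: 'c))" "bounded_linear (\<lambda>y :: 'c. (0 :: 'b, y))"
    by (intro bounded_linear_Pair bounded_linear_ident bounded_linear_zero)+
  have "polynomial_function (\<lambda>x. (f x, 0) + (0, g x))"
    by (rule polynomial_function_add[OF polynomial_function_linear_compose[OF bl(1) assms(1)]
          polynomial_function_linear_compose[OF bl(2) assms(2)]])
  then show ?thesis by simp
qed

lemmas polynomial_function_charges = bounded_linear_charges_nth[THEN polynomial_function_bounded_linear]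

lemma polynomial_function_I1: "polynomial_function (I1 :: ('n::finite) charges \<Rightarrow> real)"
proof -
  have "polynomial_function (\<lambda>Z :: 'n charges. Re ((1/2) *\<^sub>R (\<Sum>A\<in>UNIV. \<Sum>B\<in>UNIV. fst Z $ A $ B * cnj (fst Z $ A $ B))
     - (\<Sum>I\<in>UNIV. snd Z $ I * cnj (snd Z $ I))))"
    by (intro polynomial_function_linear_compose[OF bounded_linear_Re] polynomial_function_diff
        polynomial_function_cmul polynomial_function_sum finite polynomial_function_mult_complex
        polynomial_function_linear_compose[OF bounded_linear_cnj] polynomial_function_charges)
  then show ?thesis
    by (simp add: I1_def[abs_def] complex_norm_square[symmetric] del: of_real_power)
qed

lemma polynomial_function_I2: "polynomial_function (I2 :: ('n::finite) charges \<Rightarrow> complex)"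
  unfolding I2_def[abs_def] eps_ZZ_def
  by (intro polynomial_function_diff polynomial_function_sum finite polynomial_function_mult_complex
      polynomial_function_const polynomial_function_linear_compose[OF bounded_linear_cnj] polynomial_function_charges)

section \<open>Identity principle and even-odd splitting\<close>

lemma real_polynomial_vanishing:
  fixes p :: "real \<Rightarrow> real"
  assumes p: "real_polynomial_function p" and e: "e > 0" "\<And>t. 0 < t \<Longrightarrow> t < e \<Longrightarrow> p t = 0"
  shows "p x = 0"
proof -
  obtain a n where a: "p = (\<lambda>x. \<Sum>i\<le>n. a i * x ^ i)"
    using real_polynomial_function_imp_sum[OF p] by blast
  have "infinite {0<..<e}" using e(1) by (simp add: infinite_Ioo)
  moreover have "{0<..<e} \<subseteq> {x. p x = 0}" using e(2) by auto
  ultimately have "infinite {x. p x = 0}" by (rule infinite_super[rotated])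
  then have "\<forall>i\<le>n. a i = 0" unfolding a polyfun_finite_roots by blast
  then show ?thesis by (simp add: a)
qed

text \<open>On the line through \<open>x0\<close> and \<open>x\<close> this is a polynomial in one
  real variable with infinitely many zeros near \<open>t = 0\<close>; \<open>x\<close> sits at
  \<open>t = 1\<close>.\<close>

lemma polynomial_vanishing_on_line:
  fixes f :: "'a::real_normed_vector \<Rightarrow> complex"
  assumes f: "polynomial_function f"
    and ev: "eventually (\<lambda>t::real. f (x0 + t *\<^sub>R (x - x0)) = 0) (at_right 0)"
  shows "f x = 0"
proof -
  obtain e where e: "e > 0" "\<And>t. 0 < t \<Longrightarrow> t < e \<Longrightarrow> f (x0 + t *\<^sub>R (x - x0)) = 0"
    using ev unfolding eventually_at_right_field by auto
  have "polynomial_function (\<lambda>t::real. x0 + t *\<^sub>R (x - x0))"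
    by (intro polynomial_function_add polynomial_function_mult polynomial_function_const polynomial_function_id)
  from polynomial_function_compose[OF this f]
  have P: "polynomial_function (\<lambda>t::real. f (x0 + t *\<^sub>R (x - x0)))" by (simp add: o_def)
  have "Re (f (x0 + 1 *\<^sub>R (x - x0))) = 0"
    by (rule real_polynomial_vanishing[of "\<lambda>t. Re (f (x0 + t *\<^sub>R (x - x0)))" e])
      (use polynomial_function_linear_compose[OF bounded_linear_Re P] e in \<open>auto simp: real_polynomial_function_eq\<close>)
  moreover have "Im (f (x0 + 1 *\<^sub>R (x - x0))) = 0"
    by (rule real_polynomial_vanishing[of "\<lambda>t. Im (f (x0 + t *\<^sub>R (x - x0)))" e])
      (use polynomial_function_linear_compose[OF bounded_linear_Im P] e in \<open>auto simp: real_polynomial_function_eq\<close>)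
  ultimately show ?thesis by (simp add: complex_eq_iff)
qed

lemma real_polynomial_even_odd_split:
  fixes p :: "'a::real_normed_vector \<times> real \<Rightarrow> real"
  assumes "real_polynomial_function p"
  shows "\<exists>q r. real_polynomial_function q \<and> real_polynomial_function r \<and>
    (\<forall>u c. p (u, c) = q (u, c\<^sup>2) + c * r (u, c\<^sup>2))"
  using assms
proof induction
  case (linear f)
  have split: "f (u, c) = f (u, 0) + c * f (0, 1)" for u c
  proof -
    have "f (u, c) = f ((u, 0) + c *\<^sub>R (0, 1))" by simp
    then show ?thesis
      using linear by (simp only: linear_add linear_scale bounded_linear.linear real_scaleR_def)
  qed
  have "real_polynomial_function (\<lambda>x :: 'a \<times> real. f (fst x, 0))"
    by (intro real_polynomial_function.intros(1) bounded_linear_compose[OF linear bounded_linear_Pair]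
        bounded_linear_fst bounded_linear_zero)
  moreover have "\<forall>u c. f (u, c) = f (fst (u, c\<^sup>2), 0) + c * f (0, 1)"
    unfolding fst_conv using split by blast
  ultimately show ?case
    using real_polynomial_function.intros(2)[of "f (0, 1)"] by blast
next
  case (const k)
  show ?case
    by (rule exI[of _ "\<lambda>x. k"], rule exI[of _ "\<lambda>x. 0"]) (simp add: real_polynomial_function.intros(2))
next
  case (add f g)
  then obtain q r q' r' where *: "real_polynomial_function q" "real_polynomial_function r"
    "real_polynomial_function q'" "real_polynomial_function r'"
    "\<forall>u c. f (u, c) = q (u, c\<^sup>2) + c * r (u, c\<^sup>2)" "\<forall>u c. g (u, c) = q' (u, c\<^sup>2) + c * r' (u, c\<^sup>2)"
    by metis
  show ?case
    by (rule exI[of _ "\<lambda>x. q x + q' x"], rule exI[of _ "\<lambda>x. r x + r' x"])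
       (simp add: * real_polynomial_function.intros(3) algebra_simps)
next
  case (mult f g)
  then obtain q r q' r' where *: "real_polynomial_function q" "real_polynomial_function r"
    "real_polynomial_function q'" "real_polynomial_function r'"
    "\<forall>u c. f (u, c) = q (u, c\<^sup>2) + c * r (u, c\<^sup>2)" "\<forall>u c. g (u, c) = q' (u, c\<^sup>2) + c * r' (u, c\<^sup>2)"
    by metis
  \<comment> \<open>The square of \<open>c\<close> arising from the two odd parts is absorbed into
    the even part as \<open>snd x\<close>.\<close>
  show ?case
    by (rule exI[of _ "\<lambda>x. q x * q' x + snd x * (r x * r' x)"], rule exI[of _ "\<lambda>x. q x * r' x + r x * q' x"])
       (simp add: * real_polynomial_function.intros(3,4) real_polynomial_function.intros(1)[OF bounded_linear_snd]
          algebra_simps power2_eq_square)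
qed

lemma polynomial_even_odd_split:
  fixes p :: "'a::real_normed_vector \<times> real \<Rightarrow> complex"
  assumes p: "polynomial_function p"
  obtains q r where "polynomial_function q" "polynomial_function r"
    "\<And>u c. p (u, c) = q (u, c\<^sup>2) + c *\<^sub>R r (u, c\<^sup>2)"
proof -
  have "real_polynomial_function (\<lambda>x. Re (p x))" "real_polynomial_function (\<lambda>x. Im (p x))"
    using polynomial_function_linear_compose[OF bounded_linear_Re p]
      polynomial_function_linear_compose[OF bounded_linear_Im p] by (simp_all add: real_polynomial_function_eq)
  then obtain q r q' r' where *: "real_polynomial_function q" "real_polynomial_function r"
    "real_polynomial_function q'" "real_polynomial_function r'"
    "\<forall>u c. Re (p (u, c)) = q (u, c\<^sup>2) + c * r (u, c\<^sup>2)" "\<forall>u c. Im (p (u, c)) = q' (u, c\<^sup>2) + c * r' (u, c\<^sup>2)"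
    using real_polynomial_even_odd_split by metis
  show ?thesis
  proof
    show "polynomial_function (\<lambda>x. q x *\<^sub>R 1 + q' x *\<^sub>R \<i>)" "polynomial_function (\<lambda>x. r x *\<^sub>R 1 + r' x *\<^sub>R \<i>)"
      using * unfolding real_polynomial_function_eq
      by (auto intro!: polynomial_function_add polynomial_function_mult polynomial_function_const simp del: scaleR_complex.simps)
    show "p (u, c) = q (u, c\<^sup>2) *\<^sub>R 1 + q' (u, c\<^sup>2) *\<^sub>R \<i> + c *\<^sub>R (r (u, c\<^sup>2) *\<^sub>R 1 + r' (u, c\<^sup>2) *\<^sub>R \<i>)" for u c
      using * by (simp add: complex_eq_iff)
  qed
qed

text \<open>The charges with \<open>X = a + \<i> b\<close>, \<open>a = e + (A/2) f\<close> and \<open>b = B f + c g\<close>, where \<open>e, f\<close> are null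
  with \<open>e \<cdot> f = 1\<close> and \<open>g\<close> is a unit vector orthogonal to both: the Gram matrix of \<open>(a, b)\<close> has
  the entries \<open>A\<close>, \<open>B\<close>, \<open>c\<^sup>2\<close>, and the dependence on \<open>(A, B, c)\<close> is affine.\<close>

definition slice :: "(real \<times> real) \<times> real \<Rightarrow> ('n::finite) charges" where
  "slice = (\<lambda>((A, B), c).
     (skew_diag (of_real (1 / sqrt 2) * (of_real ((1 + A) / 2 - c) + \<i> * of_real B))
                (of_real (1 / sqrt 2) * (of_real ((1 + A) / 2 + c) + \<i> * of_real B)),
      axis undefined (of_real ((1 - A) / 2) + \<i> * of_real B)))"

lemma slice_charge_space: "slice x \<in> charge_space"
  by (cases x) (auto simp: slice_def skew_diag_charge_space split: prod.splits)

lemma slice_invariants: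
  "I1 (slice ((A, B), c)) = A + c\<^sup>2"
  "I2 (slice ((A, B), c)) = of_real (A - c\<^sup>2) + 2 * \<i> * of_real B"
proof -
  have s: "complex_of_real (1 / sqrt 2) * complex_of_real (1 / sqrt 2) = 1 / 2"
    unfolding of_real_mult[symmetric] by simp
  \<comment> \<open>\<open>undefined\<close> is an arbitrary fixed matter index; one exists because
    types are nonempty.\<close>
  have ax: "(\<Sum>I\<in>UNIV. f (axis undefined m $ I)) = f m" if "f 0 = 0" for f :: "complex \<Rightarrow> 'c::comm_monoid_add" and m
    using that by (simp add: axis_def if_distrib[of f] cong: if_cong)
  have h: "(cmod (complex_of_real (1 / sqrt 2) * m))\<^sup>2 = ((Re m)\<^sup>2 + (Im m)\<^sup>2) / 2" for m
    by (simp add: norm_mult norm_divide power_divide cmod_power2)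
  have "I1 (slice ((A, B), c)) = (((1 + A) / 2 - c)\<^sup>2 + B\<^sup>2) / 2 + (((1 + A) / 2 + c)\<^sup>2 + B\<^sup>2) / 2
      - (((1 - A) / 2)\<^sup>2 + B\<^sup>2)"
    unfolding slice_def prod.case skew_diag_I1_I2 h by (subst ax) (simp_all add: cmod_power2)
  also have "\<dots> = A + c\<^sup>2" by (simp add: power2_eq_square field_simps)
  finally show "I1 (slice ((A, B), c)) = A + c\<^sup>2" .
  have "I2 (slice ((A, B), c)) = 2 * (complex_of_real (1 / sqrt 2) * complex_of_real (1 / sqrt 2)) *
     ((of_real ((1 + A) / 2 - c) + \<i> * of_real B) * (of_real ((1 + A) / 2 + c) + \<i> * of_real B))
     - cnj (of_real ((1 - A) / 2) + \<i> * of_real B) * cnj (of_real ((1 - A) / 2) + \<i> * of_real B)"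
    unfolding slice_def prod.case skew_diag_I1_I2 by (subst ax) (simp_all add: mult_ac)
  also have "\<dots> = of_real (A - c\<^sup>2) + 2 * \<i> * of_real B"
    unfolding s by (simp add: complex_eq_iff power2_eq_square field_simps)
  finally show "I2 (slice ((A, B), c)) = of_real (A - c\<^sup>2) + 2 * \<i> * of_real B" .
qed

lemma polynomial_function_slice: "polynomial_function (slice :: _ \<Rightarrow> ('n::finite) charges)"
proof -
  define k where "k = complex_of_real (1 / sqrt 2)"
  define S0 :: "'n charges" where "S0 = (skew_diag (k / 2) (k / 2), axis undefined (1 / 2))"
  define S1 :: "'n charges" where "S1 = (skew_diag (k / 2) (k / 2), axis undefined (- 1 / 2))"
  define S2 :: "'n charges" where "S2 = (skew_diag (k * \<i>) (k * \<i>), axis undefined \<i>)"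
  define S3 :: "'n charges" where "S3 = (skew_diag (- k) k, 0)"
  have "slice x = S0 + fst (fst x) *\<^sub>R S1 + snd (fst x) *\<^sub>R S2 + snd x *\<^sub>R S3" for x
  proof -
    obtain A B c where x: "x = ((A, B), c)" by (metis prod.collapse)
    show ?thesis
      unfolding x slice_def prod.case k_def[symmetric] prod_eq_iff vec_eq_iff forall_4
      by (auto simp: S0_def S1_def S2_def S3_def axis_def scaleR_conv_of_real[where 'a=complex] field_simps)
  qed
  then have "slice = (\<lambda>x. S0 + fst (fst x) *\<^sub>R S1 + snd (fst x) *\<^sub>R S2 + snd x *\<^sub>R S3)" by (rule ext)
  moreover have "polynomial_function (\<lambda>x :: (real \<times> real) \<times> real. S0 + fst (fst x) *\<^sub>R S1 + snd (fst x) *\<^sub>R S2 + snd x *\<^sub>R S3)"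
    by (intro polynomial_function_add polynomial_function_mult polynomial_function_const
        polynomial_function_bounded_linear[OF bounded_linear_compose[OF bounded_linear_fst bounded_linear_fst]]
        polynomial_function_bounded_linear[OF bounded_linear_compose[OF bounded_linear_snd bounded_linear_fst]]
        polynomial_function_bounded_linear[OF bounded_linear_snd])
  ultimately show ?thesis by simp
qed

text \<open>The segment from a positive charge \<open>Z0\<close> to \<open>Z\<close> stays in the
  linear space \<open>charge_space\<close>, and by continuity starts inside the positive
  region.\<close>

lemma polynomial_eq_on_charge_space:
  fixes F G :: "('n::finite) charges \<Rightarrow> complex"
  assumes F: "polynomial_function F" and G: "polynomial_function G"
    and eq: "\<And>Z. Z \<in> charge_space \<Longrightarrow> cmod (I2 Z) < I1 Z \<Longrightarrow> F Z = G Z"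
    and Z: "Z \<in> charge_space"
  shows "F Z = G Z"
proof -
  define Z0 :: "'n charges" where "Z0 = slice ((1, 0), 1)"
  have Z0: "Z0 \<in> charge_space" "I1 Z0 = 2" "I2 Z0 = 0"
    by (simp_all add: Z0_def slice_charge_space slice_invariants)
  let ?\<gamma> = "\<lambda>t::real. Z0 + t *\<^sub>R (Z - Z0)"
  have cs: "?\<gamma> t \<in> charge_space" for t
  proof -
    have "fst Z $ A $ B = - (fst Z $ B $ A)" "fst Z0 $ A $ B = - (fst Z0 $ B $ A)" for A B
      using Z Z0(1) unfolding charge_space_iff by blast+
    then have "fst (?\<gamma> t) $ A $ B = - (fst (?\<gamma> t) $ B $ A)" for A B
      unfolding fst_add fst_scaleR fst_diff vector_add_component vector_scaleR_component vector_minus_component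
      by (metis (no_types, opaque_lifting) minus_add_distrib minus_diff_minus scaleR_minus_right)
    then show ?thesis unfolding charge_space_iff by blast
  qed
  have poly: "polynomial_function ?\<gamma>"
    by (intro polynomial_function_add polynomial_function_mult polynomial_function_const polynomial_function_id)
  have "isCont (\<lambda>t. I1 (?\<gamma> t)) 0" "isCont (\<lambda>t. I2 (?\<gamma> t)) 0"
    using polynomial_function_compose[OF poly polynomial_function_I1]
      polynomial_function_compose[OF poly polynomial_function_I2]
    by (auto intro: continuous_polymonial_function simp: o_def)
  then have "((\<lambda>t. I1 (?\<gamma> t) - cmod (I2 (?\<gamma> t))) \<longlongrightarrow> I1 (?\<gamma> 0) - cmod (I2 (?\<gamma> 0))) (at 0)"
    unfolding isCont_def by (intro tendsto_intros)
  then have "eventually (\<lambda>t. I1 (?\<gamma> t) - cmod (I2 (?\<gamma> t)) > 0) (at 0)"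
    by (rule order_tendstoD) (simp add: Z0)
  then have "eventually (\<lambda>t. I1 (?\<gamma> t) - cmod (I2 (?\<gamma> t)) > 0) (at_right 0)"
    by (rule filter_leD[OF at_le, rotated]) simp
  then have "eventually (\<lambda>t. F (?\<gamma> t) - G (?\<gamma> t) = 0) (at_right 0)"
    by (rule eventually_mono) (simp only: right_minus_eq, rule eq[OF cs], simp)
  then have "F Z - G Z = 0"
    by (rule polynomial_vanishing_on_line[OF polynomial_function_diff[OF F G]])
  then show ?thesis by simp
qed

text \<open>Solves \<open>slice_invariants\<close> for \<open>((A, B), c\<^sup>2)\<close>.\<close>

definition gram :: "real \<times> complex \<Rightarrow> (real \<times> real) \<times> real" where
  "gram x = (((fst x + Re (snd x)) / 2, Im (snd x) / 2), (fst x - Re (snd x)) / 2)"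

lemma polynomial_function_gram: "polynomial_function gram"
proof -
  have f: "polynomial_function (\<lambda>x :: real \<times> complex. fst x)"
    and r: "polynomial_function (\<lambda>x :: real \<times> complex. Re (snd x))"
    and i: "polynomial_function (\<lambda>x :: real \<times> complex. Im (snd x))"
    by (rule polynomial_function_bounded_linear[OF bounded_linear_fst]
        polynomial_function_bounded_linear[OF bounded_linear_compose[OF bounded_linear_Re bounded_linear_snd]]
        polynomial_function_bounded_linear[OF bounded_linear_compose[OF bounded_linear_Im bounded_linear_snd]])+
  have "polynomial_function (\<lambda>x. (((1/2) *\<^sub>R (fst x + Re (snd x)), (1/2) *\<^sub>R Im (snd x)), (1/2) *\<^sub>R (fst x - Re (snd x))))"
    by (rule polynomial_function_Pair[OF polynomial_function_Pair[OF
          polynomial_function_cmul[OF polynomial_function_add[OF f r]] polynomial_function_cmul[OF i]]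
          polynomial_function_cmul[OF polynomial_function_diff[OF f r]]])
  then show ?thesis by (simp add: gram_def[abs_def])
qed

lemma slice_gram:
  assumes "c\<^sup>2 = snd (gram x)"
  shows "I1 (slice (fst (gram x), c)) = fst x" "I2 (slice (fst (gram x), c)) = snd x"
proof -
  have c: "c\<^sup>2 = (fst x - Re (snd x)) / 2" using assms by (simp add: gram_def)
  show "I1 (slice (fst (gram x), c)) = fst x"
    unfolding gram_def fst_conv slice_invariants c by (simp add: field_simps)
  show "I2 (slice (fst (gram x), c)) = snd x"
    unfolding gram_def fst_conv slice_invariants c by (simp add: complex_eq_iff field_simps)
qed

lemma polynomial_function_I1_I2: "polynomial_function (\<lambda>Z :: ('n::finite) charges. (I1 Z, I2 Z))"
  by (rule polynomial_function_Pair[OF polynomial_function_I1 polynomial_function_I2])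

lemma polynomial_invariants_generated:
  fixes F :: "('n::finite) charges \<Rightarrow> complex"
  assumes F: "polynomial_function F" and inv: "invariant_under O6n F"
  obtains f :: "real \<times> complex \<Rightarrow> complex" where "polynomial_function f"
    "\<forall>Z\<in>charge_space. F Z = f (I1 Z, I2 Z)"
proof -
  have "polynomial_function (F \<circ> slice)"
    by (rule polynomial_function_compose[OF polynomial_function_slice F])
  then obtain q r where q: "polynomial_function q"
    and qr: "\<And>u c. (F \<circ> slice) (u, c) = q (u, c\<^sup>2) + c *\<^sub>R r (u, c\<^sup>2)"
    using polynomial_even_odd_split by metis
  have f: "polynomial_function (q \<circ> gram)"
    by (rule polynomial_function_compose[OF polynomial_function_gram q])
  have "F Z = ((q \<circ> gram) \<circ> (\<lambda>Z. (I1 Z, I2 Z))) Z" if Z: "Z \<in> charge_space" for Z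
  proof (rule polynomial_eq_on_charge_space[OF F _ _ Z])
    show "polynomial_function ((q \<circ> gram) \<circ> (\<lambda>Z. (I1 Z, I2 Z)))"
      by (rule polynomial_function_compose[OF polynomial_function_I1_I2 f])
    fix Z :: "'n charges" assume Z: "Z \<in> charge_space" and pos: "cmod (I2 Z) < I1 Z"
    let ?x = "(I1 Z, I2 Z)"
    define c where "c = sqrt (snd (gram ?x))"
    have "0 \<le> snd (gram ?x)"
      using pos abs_Re_le_cmod[of "I2 Z"] by (simp add: gram_def)
    then have c: "c\<^sup>2 = snd (gram ?x)" "(- c)\<^sup>2 = snd (gram ?x)" by (simp_all add: c_def)
    have "F Z = F (slice (fst (gram ?x), c))"
      by (rule O6n_separation[OF inv Z slice_charge_space pos]) (simp_all add: slice_gram[OF c(1)])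
    \<comment> \<open>Both roots give points of the same orbit; adding the two expressions cancels
      the odd part.\<close>
    moreover have "F Z = F (slice (fst (gram ?x), - c))"
      by (rule O6n_separation[OF inv Z slice_charge_space pos]) (simp_all add: slice_gram[OF c(2)])
    ultimately have "F Z = q (gram ?x) + c *\<^sub>R r (gram ?x)" "F Z = q (gram ?x) - c *\<^sub>R r (gram ?x)"
      using qr[of "fst (gram ?x)" c] qr[of "fst (gram ?x)" "- c"] unfolding power2_minus c(1) by simp_all
    then have "2 * F Z = 2 * q (gram ?x)" by simp
    then show "F Z = ((q \<circ> gram) \<circ> (\<lambda>Z. (I1 Z, I2 Z))) Z" by simp
  qed
  then show ?thesis using that[OF f] by simp
qed

text \<open>The slice realises every pair with \<open>Re I2 \<le> I1\<close>, a half-space with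
  interior point \<open>(1, 0)\<close>.\<close>

lemma I1_I2_algebraically_independent:
  fixes f :: "real \<times> complex \<Rightarrow> complex"
  assumes f: "polynomial_function f" and 0: "\<forall>Z\<in>(charge_space :: ('n::finite) charges set). f (I1 Z, I2 Z) = 0"
  shows "f x = 0"
proof -
  have half: "f y = 0" if "Re (snd y) \<le> fst y" for y
  proof -
    have c: "(sqrt (snd (gram y)))\<^sup>2 = snd (gram y)" using that by (simp add: gram_def)
    show ?thesis
      using bspec[OF 0 slice_charge_space[of "(fst (gram y), sqrt (snd (gram y)))"]]
      by (simp add: slice_gram[OF c])
  qed
  let ?y = "\<lambda>t::real. (1, 0) + t *\<^sub>R (x - (1, 0))"
  have "((\<lambda>t. fst (?y t) - Re (snd (?y t))) \<longlongrightarrow> fst (?y 0) - Re (snd (?y 0))) (at_right 0)"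
    by (intro tendsto_intros)
  then have "eventually (\<lambda>t. fst (?y t) - Re (snd (?y t)) > 0) (at_right 0)"
    by (rule order_tendstoD) simp
  then have "eventually (\<lambda>t. f (?y t) = 0) (at_right 0)"
    by (rule eventually_mono) (rule half, simp)
  then show ?thesis by (rule polynomial_vanishing_on_line[OF f])
qed

lemma S_inv_power2: "(S_inv Z)\<^sup>2 = of_real (disc Z)"
  by (simp add: S_inv_eq)

lemma polynomial_U_duality_invariants_generated:
  fixes F :: "('n::finite) charges \<Rightarrow> complex"
  assumes F: "polynomial_function F" and inv: "invariant_under U_duality F"
  obtains h :: "complex \<Rightarrow> complex" where "polynomial_function h"
    "\<forall>Z\<in>charge_space. F Z = h ((S_inv Z)\<^sup>2)"
proof -
  have "invariant_under O6n F"
    using inv O6n_subset_U_duality unfolding invariant_under_def by blast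
  then obtain f :: "real \<times> complex \<Rightarrow> complex" where f: "polynomial_function f"
    and Ff: "\<forall>Z\<in>charge_space. F Z = f (I1 Z, I2 Z)"
    using polynomial_invariants_generated[OF F] by metis
  \<comment> \<open>On the line \<open>((1 + D) / 2, (1 - D) / 2)\<close> the quadratic form \<open>I1\<^sup>2 - \<bar>I2\<bar>\<^sup>2\<close> takes the value \<open>D\<close>.\<close>
  define l where "l = (\<lambda>z :: complex. (1/2, 1/2) + Re z *\<^sub>R (1/2 :: real, - 1/2 :: complex))"
  have "polynomial_function l"
    unfolding l_def
    by (intro polynomial_function_add polynomial_function_mult polynomial_function_const
        polynomial_function_bounded_linear[OF bounded_linear_Re])
  then have h: "polynomial_function (f \<circ> l)" by (rule polynomial_function_compose[OF _ f])
  have disc: "polynomial_function (\<lambda>Z :: 'n charges. complex_of_real (I1 Z) * of_real (I1 Z) - I2 Z * cnj (I2 Z))"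
    by (intro polynomial_function_diff polynomial_function_mult_complex polynomial_function_I2
        polynomial_function_linear_compose[OF bounded_linear_of_real polynomial_function_I1]
        polynomial_function_linear_compose[OF bounded_linear_cnj])
  have disc_eq: "(\<lambda>Z :: 'n charges. complex_of_real (I1 Z) * of_real (I1 Z) - I2 Z * cnj (I2 Z)) = (\<lambda>Z. of_real (disc Z))"
    unfolding disc_def of_real_diff complex_norm_square by (simp add: power2_eq_square)
  have "F Z = ((f \<circ> l) \<circ> (\<lambda>Z. of_real (disc Z))) Z" if Z: "Z \<in> charge_space" for Z
  proof (rule polynomial_eq_on_charge_space[OF F _ _ Z])
    show "polynomial_function ((f \<circ> l) \<circ> (\<lambda>Z :: 'n charges. of_real (disc Z)))"
      by (rule polynomial_function_compose[OF disc[unfolded disc_eq] h])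
    fix Z :: "'n charges" assume Z: "Z \<in> charge_space" and pos: "cmod (I2 Z) < I1 Z"
    define D where "D = disc Z"
    have D: "0 < D" using pos by (simp add: D_def disc_def power_strict_mono)
    \<comment> \<open>The slice point over the line \<open>l\<close>: \<open>A = 1/2\<close> and
      \<open>c\<^sup>2 = D / 2\<close> give \<open>I1 = (1 + D) / 2\<close> and
      \<open>I2 = (1 - D) / 2\<close>.\<close>
    define Z' :: "'n charges" where "Z' = slice ((1/2, 0), sqrt (D / 2))"
    have Z': "Z' \<in> charge_space" by (simp add: Z'_def slice_charge_space)
    have I: "I1 Z' = (1 + D) / 2" "I2 Z' = of_real ((1 - D) / 2)"
      using D by (simp_all add: Z'_def slice_invariants field_simps)
    have cI: "cmod (I2 Z') = \<bar>(1 - D) / 2\<bar>" unfolding I by (rule norm_of_real)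
    have "cmod (I2 Z') < I1 Z'" unfolding cI unfolding I using D by simp
    moreover have "disc Z = disc Z'"
      unfolding D_def[symmetric] disc_def[of Z'] cI unfolding I by (simp add: power2_eq_square field_simps)
    ultimately have "F Z = F Z'"
      by (rule U_duality_separation[OF inv Z Z' pos])
    also have "\<dots> = f (I1 Z', I2 Z')" using Ff Z' by blast
    also have "(I1 Z', I2 Z') = l (of_real D)"
      unfolding I l_def by (simp add: complex_eq_iff field_simps)
    finally show "F Z = ((f \<circ> l) \<circ> (\<lambda>Z. of_real (disc Z))) Z" by (simp add: D_def)
  qed
  then show ?thesis using that[OF h] by (simp add: S_inv_power2)
qed

section \<open>Independence of the moduli\<close>

lemma S_inv_invariant: "invariant_under U_duality S_inv"
  unfolding invariant_under_def S_inv_eq using U_duality_invariants(2) by metis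

text \<open>The derivative vanishes because the function is constant on the open set
  \<open>X\<close>; a chain rule would fail on the branch cut of \<open>csqrt\<close>.\<close>

lemma S_inv_moduli_independent:
  fixes L :: "'m::euclidean_space \<Rightarrow> ('n::finite) charges \<Rightarrow> 'n charges"
  assumes chart: "moduli_chart X L \<omega> P" and Q: "Q \<in> charge_space" and \<phi>: "\<phi> \<in> X"
  shows "S_inv (L \<phi> Q) = S_inv Q" "((\<lambda>\<psi>. S_inv (L \<psi> Q)) has_derivative (\<lambda>_. 0)) (at \<phi>)"
proof -
  have const: "S_inv (L \<psi> Q) = S_inv Q" if "\<psi> \<in> X" for \<psi>
  proof -
    have "L \<psi> \<in> U_duality" using chart that by (simp add: moduli_chart_def)
    then show ?thesis using S_inv_invariant Q unfolding invariant_under_def by blast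
  qed
  then show "S_inv (L \<phi> Q) = S_inv Q" using \<phi> by blast
  have "open X" using chart by (simp add: moduli_chart_def)
  then show "((\<lambda>\<psi>. S_inv (L \<psi> Q)) has_derivative (\<lambda>_. 0)) (at \<phi>)"
    by (rule has_derivative_transform_within_open[OF has_derivative_const _ \<phi>]) (simp add: const)
qed

theorem mainTheorem4:
  shows
    "(invariant_under O6n (I1 :: ('n::finite) charges \<Rightarrow> real) \<and>
      invariant_under O6n (I2 :: 'n charges \<Rightarrow> complex) \<and>
      invariant_under O6n (\<lambda>Z :: 'n charges. cnj (I2 Z)))
   \<and> (\<forall>F :: 'n charges \<Rightarrow> complex. polynomial_function F \<and> invariant_under O6n F \<longrightarrow>
        (\<exists>f :: real \<times> complex \<Rightarrow> complex. polynomial_function f \<and>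
           (\<forall>Z\<in>charge_space. F Z = f (I1 Z, I2 Z))))
   \<and> (\<forall>f :: real \<times> complex \<Rightarrow> complex. polynomial_function f \<and>
        (\<forall>Z\<in>(charge_space :: 'n charges set). f (I1 Z, I2 Z) = 0) \<longrightarrow> (\<forall>x. f x = 0))
   \<and> (\<forall>F :: 'n charges \<Rightarrow> complex. invariant_under O6n F \<longrightarrow>
        (\<forall>Z\<in>charge_space. \<forall>Z'\<in>charge_space.
           cmod (I2 Z) < I1 Z \<and> I1 Z = I1 Z' \<and> I2 Z = I2 Z' \<longrightarrow> F Z = F Z'))
   \<and> invariant_under U_duality (S_inv :: 'n charges \<Rightarrow> complex)
   \<and> (\<forall>F :: 'n charges \<Rightarrow> complex. polynomial_function F \<and> invariant_under U_duality F \<longrightarrow>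
        (\<exists>f :: complex \<Rightarrow> complex. polynomial_function f \<and>
           (\<forall>Z\<in>charge_space. F Z = f ((S_inv Z)\<^sup>2))))
   \<and> (\<forall>F :: 'n charges \<Rightarrow> complex. invariant_under U_duality F \<longrightarrow>
        (\<forall>Z\<in>charge_space. \<forall>Z'\<in>charge_space.
           cmod (I2 Z) < I1 Z \<and> cmod (I2 Z') < I1 Z' \<and> S_inv Z = S_inv Z' \<longrightarrow> F Z = F Z'))
   \<and> (\<forall>(X :: ('m::euclidean_space) set) (L :: 'm \<Rightarrow> 'n charges \<Rightarrow> 'n charges) \<omega> P.
        moduli_chart X L \<omega> P \<longrightarrow>
        (\<forall>Q\<in>charge_space.
           (\<forall>\<phi>\<in>X. ((\<lambda>\<psi>. S_inv (L \<psi> Q)) has_derivative (\<lambda>_. 0)) (at \<phi>)) \<and>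
           (\<exists>s. \<forall>\<phi>\<in>X. S_inv (L \<phi> Q) = s) \<and>
           (\<forall>\<phi>. attractor_point X L Q \<phi> \<longrightarrow>
              snd (L \<phi> Q) = 0 \<and> eps_ZZ (L \<phi> Q) = 0 \<and>
              S_inv (L \<phi> Q) = of_real ((BPS_mass (L \<phi> Q))\<^sup>2))))"
proof (intro conjI allI impI ballI; (elim conjE)?)
  show "invariant_under O6n (I1 :: 'n charges \<Rightarrow> real)"
    unfolding invariant_under_def using O6n_invariants(2) by blast
  show "invariant_under O6n (I2 :: 'n charges \<Rightarrow> complex)"
    unfolding invariant_under_def using O6n_invariants(3) by blast
  then show "invariant_under O6n (\<lambda>Z :: 'n charges. cnj (I2 Z))"
    unfolding invariant_under_def by simp
next
  fix F :: "'n charges \<Rightarrow> complex" assume "polynomial_function F" "invariant_under O6n F"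
  then show "\<exists>f :: real \<times> complex \<Rightarrow> complex. polynomial_function f \<and> (\<forall>Z\<in>charge_space. F Z = f (I1 Z, I2 Z))"
    using polynomial_invariants_generated by metis
next
  fix f :: "real \<times> complex \<Rightarrow> complex" and x
  assume "polynomial_function f" "\<forall>Z\<in>(charge_space :: 'n charges set). f (I1 Z, I2 Z) = 0"
  then show "f x = 0" by (rule I1_I2_algebraically_independent)
next
  fix F :: "'n charges \<Rightarrow> complex" and Z Z' :: "'n charges"
  assume "invariant_under O6n F" "Z \<in> charge_space" "Z' \<in> charge_space" "cmod (I2 Z) < I1 Z" "I1 Z = I1 Z'" "I2 Z = I2 Z'"
  then show "F Z = F Z'" by (rule O6n_separation)
next
  show "invariant_under U_duality (S_inv :: 'n charges \<Rightarrow> complex)" by (rule S_inv_invariant)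
next
  fix F :: "'n charges \<Rightarrow> complex" assume "polynomial_function F" "invariant_under U_duality F"
  then show "\<exists>f :: complex \<Rightarrow> complex. polynomial_function f \<and> (\<forall>Z\<in>charge_space. F Z = f ((S_inv Z)\<^sup>2))"
    using polynomial_U_duality_invariants_generated by metis
next
  fix F :: "'n charges \<Rightarrow> complex" and Z Z' :: "'n charges"
  assume *: "invariant_under U_duality F" "Z \<in> charge_space" "Z' \<in> charge_space"
    "cmod (I2 Z) < I1 Z" "cmod (I2 Z') < I1 Z'" and S: "S_inv Z = S_inv Z'"
  have "disc Z = disc Z'"
    using arg_cong[OF S, of "\<lambda>s. s\<^sup>2"] by (simp only: S_inv_power2 of_real_eq_iff)
  with * show "F Z = F Z'" by (rule U_duality_separation)
next
  fix X :: "'m set" and L :: "'m \<Rightarrow> 'n charges \<Rightarrow> 'n charges" and \<omega> P and Q :: "'n charges" and \<phi>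
  assume *: "moduli_chart X L \<omega> P" "Q \<in> charge_space"
  show "\<exists>s. \<forall>\<phi>\<in>X. S_inv (L \<phi> Q) = s"
    using S_inv_moduli_independent(1)[OF *] by blast
  show "((\<lambda>\<psi>. S_inv (L \<psi> Q)) has_derivative (\<lambda>_. 0)) (at \<phi>)" if "\<phi> \<in> X"
    using S_inv_moduli_independent(2)[OF * that] .
  assume "attractor_point X L Q \<phi>"
  then show "snd (L \<phi> Q) = 0" "eps_ZZ (L \<phi> Q) = 0" "S_inv (L \<phi> Q) = of_real ((BPS_mass (L \<phi> Q))\<^sup>2)"
    using attractor[OF *] by blast+
qed

end
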